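(* Let $n_1,n_2\in\mathbb{R}^+\cup\{0\}$, $g\in D_{HK}$ and $f=\mathcal{J}_a^{n_1+n_2}g$. Then $\mathcal{D}_a^{n_1}\mathcal{D}_a^{n_2}f=\mathcal{D}_a^{n_1+n_2}f$.
   Context: Fix real numbers $a<b$. $D$ denotes the distributional derivative on $(a,b)$, $D^m$ its $m$-fold iterate. Let $C_0=\{F\in C[a,b]:F(a)=0\}$. A distribution $f$ on $(a,b)$ is Henstock–Kurzweil integrable if $f=DF$ for some (unique) $F\in C_0$; $\int_c^d f=F(d)-F(c)$. $D_{HK}$ is the space of these with the Alexiewicz norm $\|f\|_A=\sup_{[a,b]}|F|$; $L^1[a,b]$ is dense in it. Riemann–Liouville fractional integral on $D_{HK}$: for $n\ge1$, $\mathcal{J}_a^nf(x)=\frac{1}{\Gamma(n)}\int_a^x(x-t)^{n-1}f(t)\,dt$; for $0<n<1$, $\mathcal{J}_a^nf(x)=\frac{1}{\Gamma(n)}\lim_{k}\int_a^x(x-t)^{n-1}f_k(t)\,dt$ with $(f_k)\subset L^1[a,b]$, $\|f_k-f\|_A\to0$; $\mathcal{J}_a^0=I$; these map $D_{HK}$ into $D_{HK}$. Riemann–Liouville fractional derivative: for $n\ge0$, $m=\lceil n\rceil$, $\mathcal{D}_a^nf=D^m\mathcal{J}_a^{m-n}f$, $\mathcal{D}_a^0=I$. *)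

theory Defs
  imports "HOL-Analysis.Analysis"
begin

text \<open>Distributions on (a,b) are represented as functionals on functions real => real,
  normalised to be 0 outside the space of test functions.\<close>

type_synonym distr = "(real \<Rightarrow> real) \<Rightarrow> real"

definition test_fun :: "real \<Rightarrow> real \<Rightarrow> (real \<Rightarrow> real) set" where
  "test_fun a b = {\<phi>. (\<forall>k x. ((deriv ^^ k) \<phi>) differentiable (at x)) \<and>
       (\<exists>c d. a < c \<and> d < b \<and> (\<forall>x. x \<notin> {c..d} \<longrightarrow> \<phi> x = 0))}"

definition regular :: "real \<Rightarrow> real \<Rightarrow> (real \<Rightarrow> real) \<Rightarrow> distr" where
  "regular a b F = (\<lambda>\<phi>. if \<phi> \<in> test_fun a b then integral {a..b} (\<lambda>x. F x * \<phi> x) else 0)"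

definition dD :: "real \<Rightarrow> real \<Rightarrow> distr \<Rightarrow> distr" where
  "dD a b T = (\<lambda>\<phi>. if \<phi> \<in> test_fun a b then - T (deriv \<phi>) else 0)"

definition C0 :: "real \<Rightarrow> real \<Rightarrow> (real \<Rightarrow> real) set" where
  "C0 a b = {F. continuous_on {a..b} F \<and> F a = 0 \<and> (\<forall>x. x \<notin> {a..b} \<longrightarrow> F x = 0)}"

definition DHK :: "real \<Rightarrow> real \<Rightarrow> distr set" where
  "DHK a b = {f. \<exists>F \<in> C0 a b. f = dD a b (regular a b F)}"

definition prim :: "real \<Rightarrow> real \<Rightarrow> distr \<Rightarrow> real \<Rightarrow> real" where
  "prim a b f = (THE F. F \<in> C0 a b \<and> f = dD a b (regular a b F))"

definition alex :: "real \<Rightarrow> real \<Rightarrow> distr \<Rightarrow> real" where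
  "alex a b f = Sup ((\<lambda>x. \<bar>prim a b f x\<bar>) ` {a..b})"

text \<open>Integral over [c,d] of f in D_HK times an absolutely continuous multiplier g,
  defined by integration by parts (Stieltjes integral of F against g written as
  the integral of F times g').\<close>
definition dint_mult :: "real \<Rightarrow> real \<Rightarrow> distr \<Rightarrow> (real \<Rightarrow> real) \<Rightarrow> real \<Rightarrow> real \<Rightarrow> real" where
  "dint_mult a b f g c d =
     prim a b f d * g d - prim a b f c * g c - integral {c..d} (\<lambda>t. prim a b f t * deriv g t)"

definition rl_kernel :: "real \<Rightarrow> real \<Rightarrow> real \<Rightarrow> real" where
  "rl_kernel n x t = (if n = 1 then 1 else (x - t) powr (n - 1))"

definition RLJ :: "real \<Rightarrow> real \<Rightarrow> real \<Rightarrow> distr \<Rightarrow> distr" where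
  "RLJ a b n f =
    (if n = 0 then f
     else if 1 \<le> n then
       regular a b (\<lambda>x. 1 / Gamma n * dint_mult a b f (rl_kernel n x) a x)
     else
       (THE g. g \<in> DHK a b \<and>
          (\<exists>fk :: nat \<Rightarrow> real \<Rightarrow> real.
             (\<forall>k. fk k absolutely_integrable_on {a..b}) \<and>
             ((\<lambda>k. alex a b (regular a b (fk k) - f)) \<longlonglongrightarrow> 0) \<and>
             ((\<lambda>k. alex a b (regular a b
                  (\<lambda>x. 1 / Gamma n * integral {a..x} (\<lambda>t. rl_kernel n x t * fk k t)) - g))
               \<longlonglongrightarrow> 0))))"

definition RLD :: "real \<Rightarrow> real \<Rightarrow> real \<Rightarrow> distr \<Rightarrow> distr" where
  "RLD a b n f = (if n = 0 then f
     else (dD a b ^^ nat \<lceil>n\<rceil>) (RLJ a b (real (nat \<lceil>n\<rceil>) - n) f))"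

end

theory Submission
  imports Defs
begin

text \<open>Write \<open>g = D F\<close> with \<open>F\<close> in \<open>C\<^sub>0\<close>. On the level of primitives the fractional integral of
  a distribution is the classical one: \<open>J\<^sup>n (D F) = D (I\<^sup>n F)\<close>. For \<open>n < 1\<close> this holds because
  \<open>I\<^sup>n\<close> commutes with \<open>I\<^sup>1\<close> on \<open>L\<^sup>1\<close> and is bounded for the sup norm, which is the Alexiewicz norm
  of the derivative; uniqueness of primitives is the du Bois-Reymond lemma. The semigroup law
  \<open>I\<^sup>p I\<^sup>q = I\<close> of order \<open>p + q\<close> (Fubini and the Beta integral) and \<open>D I\<^sup>1 = id\<close> then show that
  the derivative of order \<open>n\<close> sends \<open>D (I F)\<close> with \<open>I\<close> of order \<open>n + r\<close> to \<open>D (I\<^sup>r F)\<close>, so both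
  sides are equal to \<open>g\<close>.\<close>

subsection \<open>Test functions\<close>

text \<open>A fractional derivative can leave \<open>DHK\<close>, whereas \<open>prim\<close> and
  hence \<open>RLJ\<close> are specified only there. The nested derivative therefore cannot be
  treated formally: it must be seen that the inner one, applied to this particular f, yields a
  derivative of a function in \<open>C0\<close> again, so that the outer one can be evaluated by the
  same formula. \<open>RLJ\<close> has two unlike clauses. From order 1 on it is a function obtained
  by integration by parts; for order in (0,1) it is a definite description of a limit, which needs
  an actual approximating sequence as well as uniqueness. Both clauses are brought to the one form
  \<open>dD a b (regular a b (RLint a n F))\<close>. The singular kernel is the other obstacle: for
  L^1 data and order below 1 the fractional integral need not converge at a given point. The
  semigroup law is therefore used only for continuous data or for total order at least 1. Uniqueness
  of primitives needs enough test functions, so concrete smooth bumps have to be built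
  first.\<close>

text \<open>With \<open>P = 1\<close> and \<open>k = 0\<close> this is the classical bump exp(-1/q),
  where q = (x - c)(d - x). The factor P/q^k is the general shape that differentiation
  produces.\<close>

definition bump :: "real \<Rightarrow> real \<Rightarrow> real poly \<Rightarrow> nat \<Rightarrow> real \<Rightarrow> real" where
  "bump c d P k x =
     (if c < x \<and> x < d
      then poly P x * exp (- 1 / ((x - c) * (d - x))) / ((x - c) * (d - x)) ^ k else 0)"

text \<open>The term of index k + 2 in the exponential series of 1/q already bounds exp(1/q) from
  below. Two powers of q more than the denominator needs are kept, to make derivatives vanish at the
  ends of the support.\<close>

lemma exp_neg_inverse_le:
  fixes q :: real
  assumes "0 < q"
  shows "exp (- 1 / q) / q ^ k \<le> fact (k + 2) * q\<^sup>2"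
proof -
  have "(1 / q) ^ (k + 2) /\<^sub>R fact (k + 2) \<le> exp (1 / q)"
    using assms sum_le_suminf[of "\<lambda>n. (1 / q) ^ n /\<^sub>R fact n" "{k + 2}"]
      summable_exp_generic[of "1 / q"] by (simp add: exp_def)
  then have "1 \<le> fact (k + 2) * exp (1 / q) * q ^ (k + 2)"
    using assms by (simp add: field_simps del: fact_Suc add_2_eq_Suc')
  then have "exp (- 1 / q) \<le> fact (k + 2) * q ^ (k + 2)"
    by (simp add: exp_minus field_simps del: fact_Suc add_2_eq_Suc')
  then show ?thesis
    using assms by (simp add: divide_le_eq power_add power2_eq_square mult_ac del: fact_Suc add_2_eq_Suc')
qed

lemma bump_quadratic_bound:
  assumes "c < d"
  shows "\<exists>C. \<forall>x. \<bar>bump c d P k x\<bar> \<le> C * ((x - c) * (d - x))\<^sup>2"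
proof -
  have "bounded (poly P ` {c..d})"
    by (intro compact_imp_bounded compact_continuous_image continuous_intros) auto
  then have "\<exists>M>0. \<forall>y\<in>poly P ` {c..d}. norm y \<le> M" by (simp only: bounded_pos)
  then obtain M where M: "\<And>x. x \<in> {c..d} \<Longrightarrow> \<bar>poly P x\<bar> \<le> M" and "0 < M"
    by (metis imageI real_norm_def)
  have "\<bar>bump c d P k x\<bar> \<le> (M * fact (k + 2)) * ((x - c) * (d - x))\<^sup>2" for x
  proof (cases "c < x \<and> x < d")
    case True
    let ?q = "(x - c) * (d - x)"
    have "0 < ?q" using True by simp
    have "\<bar>bump c d P k x\<bar> = \<bar>poly P x\<bar> * (exp (- 1 / ?q) / ?q ^ k)"
      using True \<open>0 < ?q\<close> by (simp add: bump_def abs_mult del: mult_pos_pos)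
    also have "\<dots> \<le> M * (fact (k + 2) * ?q\<^sup>2)"
      using True \<open>0 < ?q\<close> \<open>0 < M\<close> by (intro mult_mono M exp_neg_inverse_le) auto
    finally show ?thesis by (simp add: mult_ac)
  next
    case False
    then show ?thesis using \<open>0 < M\<close> by (auto simp: bump_def)
  qed
  then show ?thesis by blast
qed

lemma has_derivative_zero_of_quadratic_bound:
  fixes f :: "real \<Rightarrow> real"
  assumes "0 < r" and "\<And>y. \<bar>y - x\<bar> < r \<Longrightarrow> \<bar>f y\<bar> \<le> C * (y - x)\<^sup>2"
  shows "(f has_real_derivative 0) (at x)"
proof -
  have fx: "f x = 0" using assms(2)[of x] \<open>0 < r\<close> by simp
  have "((\<lambda>y. (f y - f x) / (y - x)) \<longlongrightarrow> 0) (at x)"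
  proof (rule Lim_null_comparison)
    show "\<forall>\<^sub>F y in at x. norm ((f y - f x) / (y - x)) \<le> C * \<bar>y - x\<bar>"
      unfolding eventually_at
    proof (intro exI conjI ballI impI)
      fix y assume "y \<noteq> x \<and> dist y x < r"
      then have "\<bar>f y\<bar> \<le> C * (\<bar>y - x\<bar> * \<bar>y - x\<bar>)" "\<bar>y - x\<bar> > 0"
        using assms(2)[of y] by (auto simp: dist_real_def power2_eq_square abs_mult[symmetric])
      then show "norm ((f y - f x) / (y - x)) \<le> C * \<bar>y - x\<bar>"
        by (simp add: fx field_simps)
    qed (use assms in auto)
    show "((\<lambda>y. C * \<bar>y - x\<bar>) \<longlongrightarrow> 0) (at x)"
      by (rule tendsto_eq_intros refl | simp)+
  qed
  then show ?thesis by (simp add: has_field_derivative_iff)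
qed

text \<open>Letting the polynomial and the exponent vary makes the family closed under differentiation,
  so smoothness follows from first derivatives alone (\<^emph>\<open>smooth_coinduct\<close> below).\<close>

lemma bump_deriv:
  assumes "c < d"
  obtains P' where "\<And>x. (bump c d P k has_real_derivative bump c d P' (k + 2) x) (at x)"
proof
  define Q where "Q = [:- c, 1:] * [:d, - 1:]"
  \<comment> \<open>The numerator of the derivative of P exp(-1/Q) / Q^k over Q^(k+2): since (-1/Q)'
    = Q'/Q^2, the three summands come from P, from the power Q^k and from the exponential.\<close>
  define P' where "P' = pderiv P * Q\<^sup>2 - of_nat k * P * Q * pderiv Q + P * pderiv Q"
  have Q: "poly Q x = (x - c) * (d - x)" for x by (simp add: Q_def algebra_simps)
  fix x
  show "(bump c d P k has_real_derivative bump c d P' (k + 2) x) (at x)"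
  proof (cases "c < x \<and> x < d")
    case True
    have q: "poly Q x > 0" using True by (simp add: Q)
    let ?E = "\<lambda>x. exp (- 1 / poly Q x)"
    have 1: "((\<lambda>x. poly P x * ?E x) has_real_derivative
        poly (pderiv P) x * ?E x + poly P x * (?E x * (poly (pderiv Q) x / (poly Q x)\<^sup>2))) (at x)"
      using q by (auto intro!: derivative_eq_intros poly_DERIV simp: field_simps power2_eq_square)
    have 2: "((\<lambda>x. poly Q x ^ k) has_real_derivative
        real k * poly Q x ^ (k - 1) * poly (pderiv Q) x) (at x)"
      by (auto intro!: derivative_eq_intros poly_DERIV)
    have alg: "((p' * e + p * (e * (q' / q\<^sup>2))) * q ^ k - p * e * (real k * q ^ (k - 1) * q')) / (q ^ k * q ^ k)
        = (p' * q\<^sup>2 - real k * p * q * q' + p * q') * e / q ^ (k + 2)"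
      if "q > 0" for p p' e q' q :: real
      using that by (cases k) (simp_all add: field_simps power2_eq_square)
    have "((\<lambda>x. poly P x * ?E x / poly Q x ^ k) has_real_derivative bump c d P' (k + 2) x) (at x)"
      using DERIV_divide[OF 1 2] q alg[OF q, of "poly (pderiv P) x" "?E x" "poly P x" "poly (pderiv Q) x"] True
      by (simp add: bump_def P'_def Q power_add)
    then show ?thesis
      by (rule has_field_derivative_transform_within_open[where S = "{c<..<d}"])
        (use True in \<open>auto simp: bump_def Q\<close>)
  next
    case False
    then have z: "bump c d P' (k + 2) x = 0" by (auto simp: bump_def)
    obtain C where C: "\<And>y. \<bar>bump c d P k y\<bar> \<le> C * ((y - c) * (d - y))\<^sup>2"
      using bump_quadratic_bound[OF assms] by blast
    have "C \<ge> 0"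
    proof -
      have "0 < (((c + d) / 2 - c) * (d - (c + d) / 2))\<^sup>2"
        using assms by (intro zero_less_power mult_pos_pos) (auto simp: field_simps)
      moreover have "0 \<le> C * (((c + d) / 2 - c) * (d - (c + d) / 2))\<^sup>2"
        using C order_trans abs_ge_zero by blast
      ultimately show ?thesis by (simp add: zero_le_mult_iff)
    qed
    \<comment> \<open>For x outside (c, d) and y inside, the factor of (y - c)(d - y) belonging to
      the end on the side of x is at most |y - x|, and the other factor is at most d - c.\<close>
    have bd: "\<bar>bump c d P k y\<bar> \<le> (C * (d - c)\<^sup>2) * (y - x)\<^sup>2" for y
    proof (cases "c < y \<and> y < d")
      case True
      have "(y - c) * (d - y) \<le> (d - c) * \<bar>y - x\<bar>"
      proof (cases "x \<le> c")
        case True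
        have "(d - y) * (y - c) \<le> (d - c) * \<bar>y - x\<bar>"
          using True \<open>c < y \<and> y < d\<close> by (intro mult_mono) auto
        then show ?thesis by (simp add: mult.commute)
      next
        case False
        then show ?thesis
          using \<open>\<not> (c < x \<and> x < d)\<close> \<open>c < y \<and> y < d\<close> by (intro mult_mono) auto
      qed
      then have "((y - c) * (d - y))\<^sup>2 \<le> ((d - c) * \<bar>y - x\<bar>)\<^sup>2"
        using True by (intro power_mono) auto
      then have "C * ((y - c) * (d - y))\<^sup>2 \<le> C * ((d - c) * \<bar>y - x\<bar>)\<^sup>2"
        using \<open>C \<ge> 0\<close> by (rule mult_left_mono)
      then show ?thesis using C[of y] by (simp add: power_mult_distrib)
    next
      case False
      then show ?thesis using \<open>C \<ge> 0\<close> by (auto simp: bump_def)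
    qed
    show ?thesis unfolding z
      by (rule has_derivative_zero_of_quadratic_bound[of 1]) (use bd in auto)
  qed
qed

lemma smooth_coinduct:
  assumes "f \<in> S"
    and "\<And>g. g \<in> S \<Longrightarrow> \<exists>g' \<in> S. \<forall>x::real. (g has_real_derivative g' x) (at x)"
  shows "(deriv ^^ k) f differentiable (at x)"
proof -
  have step: "deriv g \<in> S \<and> (\<forall>x. g differentiable (at x))" if g: "g \<in> S" for g
  proof -
    obtain g' where "g' \<in> S" and g': "\<forall>x. (g has_real_derivative g' x) (at x)"
      using assms(2)[OF g] by blast
    moreover have "deriv g = g'" using g' by (auto intro: DERIV_imp_deriv)
    ultimately show ?thesis by (auto simp: real_differentiable_def)
  qed
  have "(deriv ^^ k) f \<in> S" by (induction k) (use assms(1) step in auto)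
  then show ?thesis using step by blast
qed

lemma test_funI:
  assumes "\<And>x. (\<phi> has_real_derivative \<psi> x) (at x)"
    and "\<And>k x. (deriv ^^ k) \<psi> differentiable (at x)"
    and "a < c" "d < b" "\<And>x. x \<notin> {c..d} \<Longrightarrow> \<phi> x = 0"
  shows "\<phi> \<in> test_fun a b" "deriv \<phi> = \<psi>"
proof -
  show d: "deriv \<phi> = \<psi>" using assms(1) by (auto intro: DERIV_imp_deriv)
  have "(deriv ^^ k) \<phi> differentiable (at x)" for k x
  proof (cases k)
    case 0
    then show ?thesis using assms(1) by (auto simp: real_differentiable_def)
  next
    case (Suc j)
    then show ?thesis using assms(2)[of j x] by (simp add: funpow_swap1 d)
  qed
  then show "\<phi> \<in> test_fun a b" using assms(3-5) unfolding test_fun_def by blast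
qed

lemma test_fun_deriv:
  assumes "\<phi> \<in> test_fun a b"
  shows "(\<phi> has_real_derivative deriv \<phi> x) (at x)" "deriv \<phi> \<in> test_fun a b"
    "continuous_on S \<phi>" "continuous_on S (deriv \<phi>)" "x \<notin> {a<..<b} \<Longrightarrow> \<phi> x = 0"
proof -
  have diff: "(deriv ^^ k) \<phi> differentiable (at x)" for k x
    using assms by (auto simp: test_fun_def)
  show D: "(\<phi> has_real_derivative deriv \<phi> x) (at x)" for x
    using diff[of 0 x] by (simp add: DERIV_deriv_iff_real_differentiable)
  obtain c d where cd: "a < c" "d < b" "\<And>x. x \<notin> {c..d} \<Longrightarrow> \<phi> x = 0"
    using assms by (auto simp: test_fun_def)
  have "deriv \<phi> x = 0" if "x \<notin> {c..d}" for x
  proof (rule DERIV_imp_deriv, rule has_field_derivative_transform_within_open)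
    show "open (- {c..d})" by (auto intro: open_Compl)
    show "((\<lambda>_. 0) has_real_derivative 0) (at x)" by simp
  qed (use that cd in auto)
  moreover have "(deriv ^^ k) (deriv \<phi>) differentiable (at x)" for k x
    using diff[of "Suc k" x] by (simp add: funpow_swap1)
  ultimately show "deriv \<phi> \<in> test_fun a b" using cd unfolding test_fun_def by blast
  show "continuous_on S \<phi>"
    using D by (meson DERIV_continuous continuous_at_imp_continuous_on)
  show "continuous_on S (deriv \<phi>)"
    using diff[of 1] by (auto intro!: continuous_at_imp_continuous_on differentiable_imp_continuous_within)
  show "x \<notin> {a<..<b} \<Longrightarrow> \<phi> x = 0" using cd by (auto)
qed

section \<open>Normalised bumps and the du Bois-Reymond lemma\<close>

lemma bump_continuous: "c < d \<Longrightarrow> continuous_on S (bump c d P k)"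
  by (metis bump_deriv DERIV_continuous continuous_at_imp_continuous_on)

text \<open>The normalising factor is absorbed into the constant polynomial, so the unit bump stays
  in the family that is closed under differentiation.\<close>

lemma bump_unit_mass:
  assumes "a \<le> c" "c < d" "d \<le> b"
  obtains K where "((bump c d [:K:] 0) has_integral 1) {a..b}" "0 \<le> K"
proof -
  let ?B = "bump c d [:1:] 0"
  have B0: "?B x \<ge> 0" for x by (simp add: bump_def)
  have cont: "continuous_on S ?B" for S using assms by (intro bump_continuous)
  have pos: "integral {a..b} ?B > 0"
  proof -
    have "?B ((c + d) / 2) > 0" using assms by (simp add: bump_def)
    then have "\<not> (\<forall>x\<in>{a..b}. ?B x = 0)"
      using assms by (intro notI) (auto dest!: bspec[of _ _ "(c + d) / 2"])
    then have "integral {a..b} ?B \<noteq> 0"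
      using integral_eq_0_iff[of a b ?B] cont assms B0 by auto
    moreover have "integral {a..b} ?B \<ge> 0"
      using B0 by (intro integral_nonneg integrable_continuous_real cont) auto
    ultimately show ?thesis by simp
  qed
  define K where "K = 1 / integral {a..b} ?B"
  have "bump c d [:K:] 0 = (\<lambda>x. K * ?B x)" by (auto simp: bump_def)
  moreover have "((\<lambda>x. K * ?B x) has_integral K * integral {a..b} ?B) {a..b}"
    by (intro has_integral_mult_right integrable_integral integrable_continuous_real cont)
  ultimately show ?thesis using pos by (intro that[of K]) (auto simp: K_def)
qed

text \<open>The test function is the primitive of the difference of two unit bumps around
  \<open>u\<close> and \<open>v\<close>; integrating \<open>F\<close> against the bumps approximates \<open>F u\<close> and \<open>F v\<close>.\<close>

lemma du_Bois_Reymond: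
  assumes F: "continuous_on {a..b} F"
    and zero: "\<And>\<phi>. \<phi> \<in> test_fun a b \<Longrightarrow> integral {a..b} (\<lambda>x. F x * deriv \<phi> x) = 0"
    and uv: "a < u" "u < v" "v < b"
  shows "F u = F v"
proof -
  have "\<bar>F u - F v\<bar> \<le> e" if "0 < e" for e
  proof -
    have cont: "isCont F w" if "w \<in> {a<..<b}" for w
      using continuous_on_interior[OF F, of w] that by simp
    have near: "\<exists>r>0. \<forall>y. \<bar>y - w\<bar> < r \<longrightarrow> \<bar>F y - F w\<bar> < e / 2" if "w \<in> {a<..<b}" for w
      using cont[OF that, unfolded continuous_at_eps_delta dist_real_def, rule_format, of "e / 2"]
        \<open>0 < e\<close> by auto
    obtain r1 where r1: "0 < r1" "\<And>y. \<bar>y - u\<bar> < r1 \<Longrightarrow> \<bar>F y - F u\<bar> < e / 2"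
      using near[of u] uv by auto
    obtain r2 where r2: "0 < r2" "\<And>y. \<bar>y - v\<bar> < r2 \<Longrightarrow> \<bar>F y - F v\<bar> < e / 2"
      using near[of v] uv by auto
    \<comment> \<open>\<open>r1\<close> and \<open>r2\<close> control the oscillation of F near u
      and v; the three thirds keep both supports inside (a, b) and disjoint.\<close>
    define r where "r = Min {r1, r2, (u - a) / 3, (v - u) / 3, (b - v) / 3}"
    have r_le: "r \<le> y" if "y \<in> {r1, r2, (u - a) / 3, (v - u) / 3, (b - v) / 3}" for y
      unfolding r_def using that by (intro Min_le finite.intros)
    have r0: "0 < r" "r \<le> r1" "r \<le> r2" "r \<le> (u - a) / 3" "r \<le> (v - u) / 3" "r \<le> (b - v) / 3"
      using r1(1) r2(1) uv by (simp add: r_def) (rule r_le; simp)+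
    have ord: "a < u - r" "u - r < u + r" "u + r < v - r" "v - r < v + r" "v + r < b"
      using r0 uv by (auto simp: field_simps)
    obtain K1 where K1: "(bump (u - r) (u + r) [:K1:] 0 has_integral 1) {a..b}" "0 \<le> K1"
      using bump_unit_mass[of a "u - r" "u + r" b] ord by auto
    obtain K2 where K2: "(bump (v - r) (v + r) [:K2:] 0 has_integral 1) {a..b}" "0 \<le> K2"
      using bump_unit_mass[of a "v - r" "v + r" b] ord by auto
    define B1 where "B1 = bump (u - r) (u + r) [:K1:] 0"
    define B2 where "B2 = bump (v - r) (v + r) [:K2:] 0"
    define \<psi> where "\<psi> = (\<lambda>x. B1 x - B2 x)"
    define \<phi> where "\<phi> x = integral {a..x} \<psi>" for x
    have smooth: "(deriv ^^ k) \<psi> differentiable (at x)" for k x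
    proof (rule smooth_coinduct[where
          S = "{\<lambda>x. bump (u - r) (u + r) P k x - bump (v - r) (v + r) Q l x |P Q k l. True}"])
      show "\<psi> \<in> {\<lambda>x. bump (u - r) (u + r) P k x - bump (v - r) (v + r) Q l x |P Q k l. True}"
        unfolding \<psi>_def B1_def B2_def by blast
    next
      fix g assume "g \<in> {\<lambda>x. bump (u - r) (u + r) P k x - bump (v - r) (v + r) Q l x |P Q k l. True}"
      then obtain P Q k l where g: "g = (\<lambda>x. bump (u - r) (u + r) P k x - bump (v - r) (v + r) Q l x)"
        by blast
      obtain P' where "\<And>x. (bump (u - r) (u + r) P k has_real_derivative bump (u - r) (u + r) P' (k + 2) x) (at x)"
        using bump_deriv ord by metis
      moreover obtain Q' where "\<And>x. (bump (v - r) (v + r) Q l has_real_derivative bump (v - r) (v + r) Q' (l + 2) x) (at x)"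
        using bump_deriv ord by metis
      ultimately show "\<exists>g'\<in>{\<lambda>x. bump (u - r) (u + r) P k x - bump (v - r) (v + r) Q l x |P Q k l. True}.
          \<forall>x. (g has_real_derivative g' x) (at x)"
        unfolding g
        by (intro bexI[of _ "\<lambda>x. bump (u - r) (u + r) P' (k + 2) x - bump (v - r) (v + r) Q' (l + 2) x"])
          (auto intro!: derivative_intros)
    qed
    have contB: "continuous_on S B1" "continuous_on S B2" for S
      unfolding B1_def B2_def using ord by (auto intro!: bump_continuous)
    have cont\<psi>: "continuous_on S \<psi>" for S
      unfolding \<psi>_def by (intro continuous_intros contB)
    have \<psi>0: "\<psi> x = 0" if "x \<notin> {u - r<..<v + r}" for x
      using that ord by (auto simp: \<psi>_def B1_def B2_def bump_def)
    have \<phi>_left: "\<phi> x = 0" if "x \<le> u - r" for x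
      unfolding \<phi>_def using that \<psi>0 by (intro integral_unique has_integral_is_0) auto
    \<comment> \<open>The two unit masses cancel. This is what makes the primitive vanish to the
      right of v + r and so gives it compact support.\<close>
    have \<phi>_b: "integral {a..b} \<psi> = 0"
      using has_integral_diff[OF K1(1) K2(1)] by (simp add: \<psi>_def B1_def B2_def integral_unique)
    have \<phi>_right: "\<phi> x = 0" if "v + r \<le> x" for x
    proof -
      have "integral {a..v + r} \<psi> + integral {v + r..x} \<psi> = integral {a..x} \<psi>"
        using that ord by (intro Henstock_Kurzweil_Integration.integral_combine integrable_continuous_real cont\<psi>) auto
      moreover have "integral {a..v + r} \<psi> + integral {v + r..b} \<psi> = integral {a..b} \<psi>"
        using that ord by (intro Henstock_Kurzweil_Integration.integral_combine integrable_continuous_real cont\<psi>) auto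
      moreover have "integral {v + r..x} \<psi> = 0" "integral {v + r..b} \<psi> = 0"
        using \<psi>0 by (auto intro!: integral_unique has_integral_is_0)
      ultimately show ?thesis using \<phi>_b by (simp add: \<phi>_def)
    qed
    have D: "(\<phi> has_real_derivative \<psi> x) (at x)" for x
    proof (cases "x < u - r")
      case True
      then have "\<psi> x = 0" using \<psi>0 by auto
      then show ?thesis
        using has_field_derivative_transform_within_open[of "\<lambda>_. 0" 0 x "{..<u - r}" \<phi>] True \<phi>_left
        by auto
    next
      case False
      \<comment> \<open>Here x is at least u - r and so lies strictly between a and x + 1, which
        turns the one-sided derivative into a full one. The point x may exceed b, since the
        difference of bumps is continuous on the whole line.\<close>
      have "((\<lambda>x. integral {a..x} \<psi>) has_real_derivative \<psi> x) (at x within {a..x + 1})"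
        using False ord by (intro integral_has_real_derivative cont\<psi>) auto
      moreover have "at x within {a..x + 1} = at x"
        using False ord by (intro at_within_interior) auto
      ultimately show ?thesis by (simp add: \<phi>_def[abs_def])
    qed
    have "\<phi> x = 0" if "x \<notin> {u - r..v + r}" for x
      using that \<phi>_left[of x] \<phi>_right[of x] by auto
    then have "\<phi> \<in> test_fun a b" and d\<phi>: "deriv \<phi> = \<psi>"
      using test_funI[OF D smooth ord(1,5)] by blast+
    then have z: "integral {a..b} (\<lambda>x. F x * \<psi> x) = 0" using zero by metis
    \<comment> \<open>The mean of F against a nonnegative kernel of mass 1 is as close to C as F is
      on the support of the kernel.\<close>
    have int1: "\<bar>integral {a..b} (\<lambda>x. (F x - C) * B x)\<bar> \<le> e / 2"
      if B: "continuous_on {a..b} B" "(B has_integral 1) {a..b}" "\<And>x. B x \<ge> 0"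
        and C: "\<And>x. x \<in> {a..b} \<Longrightarrow> B x \<noteq> 0 \<Longrightarrow> \<bar>F x - C\<bar> < e / 2" for B C
    proof -
      have "norm (integral {a..b} (\<lambda>x. (F x - C) * B x)) \<le> integral {a..b} (\<lambda>x. e / 2 * B x)"
      proof (rule integral_norm_bound_integral)
        show "(\<lambda>x. (F x - C) * B x) integrable_on {a..b}" "(\<lambda>x. e / 2 * B x) integrable_on {a..b}"
          using B(1) F by (auto intro!: integrable_continuous_real continuous_intros)
        fix x assume x: "x \<in> {a..b}"
        then have "\<bar>F x - C\<bar> * B x \<le> e / 2 * B x"
          using C[OF x] B(3)[of x] by (cases "B x = 0") (auto intro!: mult_right_mono)
        then show "norm ((F x - C) * B x) \<le> e / 2 * B x"
          using B(3)[of x] by (simp add: abs_mult)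
      qed
      also have "\<dots> = e / 2" using B(2) by (simp add: integral_unique)
      finally show ?thesis by simp
    qed
    have shift: "integral {a..b} (\<lambda>x. (F x - C) * B x) = integral {a..b} (\<lambda>x. F x * B x) - C"
      if B: "continuous_on {a..b} B" "(B has_integral 1) {a..b}" for B C
    proof -
      have "integral {a..b} (\<lambda>x. (F x - C) * B x)
          = integral {a..b} (\<lambda>x. F x * B x) - integral {a..b} (\<lambda>x. C * B x)"
        using B(1) F by (subst integral_diff[symmetric])
          (auto intro!: integrable_continuous_real continuous_intros simp: algebra_simps)
      then show ?thesis using B(2) by (simp add: integral_unique)
    qed
    have "\<bar>integral {a..b} (\<lambda>x. F x * B1 x) - F u\<bar> \<le> e / 2"
      using int1[of B1 "F u"] shift[of B1 "F u"] contB K1 r1(2) r0(2)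
      by (auto simp: B1_def bump_def split: if_splits)
    moreover have "\<bar>integral {a..b} (\<lambda>x. F x * B2 x) - F v\<bar> \<le> e / 2"
      using int1[of B2 "F v"] shift[of B2 "F v"] contB K2 r2(2) r0(3)
      by (auto simp: B2_def bump_def split: if_splits)
    moreover have "integral {a..b} (\<lambda>x. F x * B1 x) = integral {a..b} (\<lambda>x. F x * B2 x)"
      using z F contB unfolding \<psi>_def right_diff_distrib
      by (subst (asm) integral_diff) (auto intro!: integrable_continuous_real continuous_intros)
    ultimately show ?thesis by linarith
  qed
  then show ?thesis
    by (metis abs_le_zero_iff eq_iff_diff_eq_0 field_le_epsilon add_0)
qed

subsection \<open>Fubini on a triangle\<close>

text \<open>Fubini is applied on the product of two copies of \<open>lborel\<close>, while the
  integrals of the development are Henstock-Kurzweil ones. This lemma and the next two translate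
  between them; Borel measurability of g is what allows the completion to be dropped.\<close>

lemma abs_integrable_iff_lborel:
  fixes g :: "real \<Rightarrow> real"
  assumes [measurable]: "g \<in> borel_measurable borel" "S \<in> sets borel"
  shows "g absolutely_integrable_on S \<longleftrightarrow> integrable lborel (\<lambda>x. indicator S x * g x)"
  by (simp add: set_integrable_def integrable_completion)

lemma lborel_integral_eq:
  fixes g :: "real \<Rightarrow> real"
  assumes "integrable lborel (\<lambda>x. indicator S x * g x)"
  shows "(\<integral>x. indicator S x * g x \<partial>lborel) = integral S g"
  using set_borel_integral_eq_integral(2)[of S g] assms
  by (simp add: set_integrable_def set_lebesgue_integral_def)

lemma negligible_if_AE_lborel:
  fixes P :: "real \<Rightarrow> bool"
  assumes "AE x in lborel. P x"
  shows "negligible {x. \<not> P x}"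
proof -
  obtain N where N: "N \<in> null_sets lborel" "{x. \<not> P x} \<subseteq> N"
    using assms by (auto simp: eventually_ae_filter)
  have "negligible N"
    using N(1) by (simp add: negligible_iff_null_sets null_sets_completionI)
  then show ?thesis using N(2) negligible_subset by blast
qed

text \<open>The integrand on the triangle a <= t <= s <= x is extended by zero to the plane.
  \<open>Ks\<close> and \<open>Kf\<close> are then the two parts of the criterion for joint
  integrability: every section in s is integrable, and the integrals of the absolute values are
  integrable in t.\<close>

lemma triangle_Fubini_borel:
  fixes f :: "real \<Rightarrow> real" and K :: "real \<Rightarrow> real \<Rightarrow> real"
  assumes f [measurable]: "f \<in> borel_measurable borel"
    and K [measurable]: "case_prod K \<in> borel_measurable (borel \<Otimes>\<^sub>M borel)"
    and Ks: "\<And>t. t \<in> {a..x} \<Longrightarrow> (\<lambda>s. K s t) absolutely_integrable_on {t..x}"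
    and Kf: "(\<lambda>t. integral {t..x} (\<lambda>s. \<bar>K s t\<bar>) * \<bar>f t\<bar>) integrable_on {a..x}"
  shows "(\<lambda>s. integral {a..s} (\<lambda>t. K s t * f t)) absolutely_integrable_on {a..x}"
    and "integral {a..x} (\<lambda>s. integral {a..s} (\<lambda>t. K s t * f t))
       = integral {a..x} (\<lambda>t. f t * integral {t..x} (\<lambda>s. K s t))"
proof -
  define G where "G t s = indicator {a..x} t * (indicator {t..x} s * K s t * f t)" for t s
  have ind: "indicator {t..x} s = (if t \<le> s \<and> s \<le> x then 1 else 0 :: real)" for t s
    by (auto simp: indicator_def)
  have G0: "G t s = 0" if "s \<notin> {a..x}" for t s
  proof -
    have "t \<notin> {a..x} \<or> s \<notin> {t..x}" using that by auto
    then show ?thesis unfolding G_def by (elim disjE; simp)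
  qed
  have "case_prod G \<in> borel_measurable (borel \<Otimes>\<^sub>M borel)"
    unfolding G_def ind by measurable
  then have G [measurable]: "case_prod G \<in> borel_measurable (lborel \<Otimes>\<^sub>M lborel)"
    by (simp cong: measurable_cong_sets)
  have Kt [measurable]: "(\<lambda>s. K s t) \<in> borel_measurable borel" for t by measurable
  have Kint: "integrable lborel (\<lambda>s. indicator {t..x} s * K s t)"
      "integrable lborel (\<lambda>s. indicator {t..x} s * \<bar>K s t\<bar>)" if "t \<in> {a..x}" for t
    using Ks[OF that] set_integrable_abs[OF Ks[OF that]]
    by (simp_all add: abs_integrable_iff_lborel)
  have Gt: "integrable lborel (G t)" for t
    using Kint(1)[of t] by (auto simp: G_def[abs_def] indicator_def[of "{a..x}"])
  have absG: "(\<integral>s. norm (G t s) \<partial>lborel)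
      = indicator {a..x} t * (integral {t..x} (\<lambda>s. \<bar>K s t\<bar>) * \<bar>f t\<bar>)" for t
  proof (cases "t \<in> {a..x}")
    case True
    have "(\<integral>s. norm (G t s) \<partial>lborel) = (\<integral>s. (indicator {t..x} s * \<bar>K s t\<bar>) * \<bar>f t\<bar> \<partial>lborel)"
      using True by (intro Bochner_Integration.integral_cong) (auto simp: G_def abs_mult)
    also have "\<dots> = (\<integral>s. indicator {t..x} s * \<bar>K s t\<bar> \<partial>lborel) * \<bar>f t\<bar>"
      by (rule integral_mult_left_zero)
    finally show ?thesis using True by (simp add: lborel_integral_eq[OF Kint(2)[OF True]])
  qed (simp add: G_def)
  have "(\<lambda>t. \<integral>s. norm (G t s) \<partial>lborel) \<in> borel_measurable lborel"
    by measurable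
  then have absG_meas: "(\<lambda>t. indicator {a..x} t * (integral {t..x} (\<lambda>s. \<bar>K s t\<bar>) * \<bar>f t\<bar>)) \<in> borel_measurable borel"
    unfolding absG by simp
  have "(\<lambda>t. indicator {a..x} t * (integral {t..x} (\<lambda>s. \<bar>K s t\<bar>) * \<bar>f t\<bar>)) absolutely_integrable_on UNIV"
  proof (rule nonnegative_absolutely_integrable_1)
    have "(\<lambda>t. if t \<in> {a..x} then integral {t..x} (\<lambda>s. \<bar>K s t\<bar>) * \<bar>f t\<bar> else 0) integrable_on UNIV"
      using Kf by (simp only: integrable_restrict_UNIV)
    then show "(\<lambda>t. indicator {a..x} t * (integral {t..x} (\<lambda>s. \<bar>K s t\<bar>) * \<bar>f t\<bar>)) integrable_on UNIV"
      by (rule integrable_eq) (auto simp: indicator_def)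
    show "0 \<le> indicator {a..x} t * (integral {t..x} (\<lambda>s. \<bar>K s t\<bar>) * \<bar>f t\<bar>)" for t
      unfolding absG[symmetric] by (rule Bochner_Integration.integral_nonneg) simp
  qed
  then have "integrable lborel (\<lambda>t. \<integral>s. norm (G t s) \<partial>lborel)"
    unfolding absG using abs_integrable_iff_lborel[OF absG_meas] by simp
  then have int: "integrable (lborel \<Otimes>\<^sub>M lborel) (case_prod G)"
    using Gt G by (intro lborel_pair.Fubini_integrable) auto
  \<comment> \<open>For s in N the section is not Lebesgue integrable, and its Lebesgue integral
    need not agree with the \<open>integral\<close> in the conclusion. Fubini makes N negligible, so
    such s can be ignored.\<close>
  define N where "N = {s. \<not> integrable lborel (\<lambda>t. G t s)}"
  have N: "negligible N"
    unfolding N_def by (intro negligible_if_AE_lborel lborel_pair.AE_integrable_snd int)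
  have inner_s: "(\<integral>t. G t s \<partial>lborel) = indicator {a..x} s * integral {a..s} (\<lambda>t. K s t * f t)"
    if "s \<notin> N" for s
  proof (cases "s \<in> {a..x}")
    case True
    have eq: "G t s = indicator {a..s} t * (K s t * f t)" for t
      using True by (auto simp: G_def indicator_def)
    show ?thesis
      using that True lborel_integral_eq[of "{a..s}" "\<lambda>t. K s t * f t"] by (simp add: eq N_def)
  next
    case False
    then show ?thesis by (simp add: G0)
  qed
  have int_s: "integrable lborel (\<lambda>s. \<integral>t. G t s \<partial>lborel)"
    using lborel_pair.integrable_snd[OF int] .
  then have abs_s: "(\<lambda>s. \<integral>t. G t s \<partial>lborel) absolutely_integrable_on UNIV"
    by (subst abs_integrable_iff_lborel) auto
  then have "(\<lambda>s. \<integral>t. G t s \<partial>lborel) absolutely_integrable_on {a..x}"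
    by (rule set_integrable_subset) auto
  then show "(\<lambda>s. integral {a..s} (\<lambda>t. K s t * f t)) absolutely_integrable_on {a..x}"
    by (rule absolutely_integrable_spike[OF _ N]) (use inner_s in auto)
  have "integral {a..x} (\<lambda>s. integral {a..s} (\<lambda>t. K s t * f t)) = integral {a..x} (\<lambda>s. \<integral>t. G t s \<partial>lborel)"
    using inner_s by (intro integral_spike[OF N]) auto
  also have "\<dots> = integral UNIV (\<lambda>s. \<integral>t. G t s \<partial>lborel)"
  proof -
    have "(if s \<in> {a..x} then \<integral>t. G t s \<partial>lborel else 0) = (\<integral>t. G t s \<partial>lborel)" for s
      by (simp add: G0)
    then show ?thesis
      using integral_restrict_UNIV[of "{a..x}" "\<lambda>s. \<integral>t. G t s \<partial>lborel"] by simp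
  qed
  also have "\<dots> = (\<integral>s. (\<integral>t. G t s \<partial>lborel) \<partial>lborel)"
    using lborel_integral_eq[of UNIV "\<lambda>s. \<integral>t. G t s \<partial>lborel"] int_s by simp
  also have "\<dots> = (\<integral>t. (\<integral>s. G t s \<partial>lborel) \<partial>lborel)"
    by (rule lborel_pair.Fubini_integral[OF int])
  also have outer: "(\<lambda>t. \<integral>s. G t s \<partial>lborel)
      = (\<lambda>t. indicator {a..x} t * (f t * integral {t..x} (\<lambda>s. K s t)))"
  proof
    fix t
    show "(\<integral>s. G t s \<partial>lborel) = indicator {a..x} t * (f t * integral {t..x} (\<lambda>s. K s t))"
    proof (cases "t \<in> {a..x}")
      case True
      have "(\<integral>s. G t s \<partial>lborel) = (\<integral>s. (indicator {t..x} s * K s t) * f t \<partial>lborel)"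
        using True by (intro Bochner_Integration.integral_cong) (auto simp: G_def)
      also have "\<dots> = (\<integral>s. indicator {t..x} s * K s t \<partial>lborel) * f t"
        by (rule integral_mult_left_zero)
      finally show ?thesis using True by (simp add: lborel_integral_eq[OF Kint(1)[OF True]])
    qed (simp add: G_def)
  qed
  also have "(\<integral>t. indicator {a..x} t * (f t * integral {t..x} (\<lambda>s. K s t)) \<partial>lborel)
      = integral {a..x} (\<lambda>t. f t * integral {t..x} (\<lambda>s. K s t))"
    using lborel_pair.integrable_fst[OF int]
    by (intro lborel_integral_eq) (simp only: outer)
  finally show "integral {a..x} (\<lambda>s. integral {a..s} (\<lambda>t. K s t * f t))
       = integral {a..x} (\<lambda>t. f t * integral {t..x} (\<lambda>s. K s t))" .
qed

text \<open>An absolutely integrable f is only Lebesgue measurable, which is too weak for the Borel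
  product. It is replaced by a Borel function that agrees with it off a negligible set; no integral
  in the statement changes.\<close>

lemma triangle_Fubini:
  fixes f :: "real \<Rightarrow> real" and K :: "real \<Rightarrow> real \<Rightarrow> real"
  assumes f: "f absolutely_integrable_on {a..x}"
    and K: "case_prod K \<in> borel_measurable (borel \<Otimes>\<^sub>M borel)"
    and Ks: "\<And>t. t \<in> {a..x} \<Longrightarrow> (\<lambda>s. K s t) absolutely_integrable_on {t..x}"
    and Kf: "(\<lambda>t. integral {t..x} (\<lambda>s. \<bar>K s t\<bar>) * \<bar>f t\<bar>) integrable_on {a..x}"
  shows "(\<lambda>s. integral {a..s} (\<lambda>t. K s t * f t)) absolutely_integrable_on {a..x}"
    and "integral {a..x} (\<lambda>s. integral {a..s} (\<lambda>t. K s t * f t))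
       = integral {a..x} (\<lambda>t. f t * integral {t..x} (\<lambda>s. K s t))"
proof -
  have "(\<lambda>t. if t \<in> {a..x} then f t else 0) \<in> borel_measurable lebesgue"
    using f absolutely_integrable_measurable[of "{a..x}" f] borel_measurable_if[of "{a..x}" f] by auto
  then obtain g where g: "g \<in> borel_measurable borel"
    "AE t in lborel. (if t \<in> {a..x} then f t else 0) = g t"
    using completion_ex_borel_measurable_real[of _ lborel] by auto
  define N where "N = {t. (if t \<in> {a..x} then f t else 0) \<noteq> g t}"
  have N: "negligible N"
    unfolding N_def by (intro negligible_if_AE_lborel g(2))
  have fg: "f t = g t" if "t \<in> {a..x}" "t \<notin> N" for t
    using that by (auto simp: N_def)
  have "(\<lambda>t. integral {t..x} (\<lambda>s. \<bar>K s t\<bar>) * \<bar>g t\<bar>) integrable_on {a..x}"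
    by (rule integrable_spike[OF Kf N]) (use fg in auto)
  note * = triangle_Fubini_borel[OF g(1) K Ks this]
  have eq: "integral {a..s} (\<lambda>t. K s t * f t) = integral {a..s} (\<lambda>t. K s t * g t)" if "s \<in> {a..x}" for s
    using that fg by (intro integral_spike[OF N]) auto
  show "(\<lambda>s. integral {a..s} (\<lambda>t. K s t * f t)) absolutely_integrable_on {a..x}"
    using *(1) by (rule absolutely_integrable_spike[of _ _ "{}"]) (use eq in auto)
  have "integral {a..x} (\<lambda>s. integral {a..s} (\<lambda>t. K s t * f t))
      = integral {a..x} (\<lambda>s. integral {a..s} (\<lambda>t. K s t * g t))"
    by (intro integral_cong eq)
  also have "\<dots> = integral {a..x} (\<lambda>t. g t * integral {t..x} (\<lambda>s. K s t))"
    by (rule *(2))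
  also have "\<dots> = integral {a..x} (\<lambda>t. f t * integral {t..x} (\<lambda>s. K s t))"
    using fg by (intro integral_spike[OF N]) auto
  finally show "integral {a..x} (\<lambda>s. integral {a..s} (\<lambda>t. K s t * f t))
       = integral {a..x} (\<lambda>t. f t * integral {t..x} (\<lambda>s. K s t))" .
qed

subsection \<open>The Riemann--Liouville integral of functions\<close>

text \<open>Order 0 needs its own clause: \<open>Gamma 0 = 0\<close> and division by zero would give
  the zero function instead of the identity.\<close>

definition RLint :: "real \<Rightarrow> real \<Rightarrow> (real \<Rightarrow> real) \<Rightarrow> real \<Rightarrow> real" where
  "RLint a n f x =
     (if n = 0 then f x else integral {a..x} (\<lambda>t. (x - t) powr (n - 1) * f t) / Gamma n)"

text \<open>The affine map of [t, x] onto [0, 1] turns this into the Beta integral. With l = x - t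
  the kernels contribute l^(p+q-2) and the change of variable one more factor l.\<close>

lemma has_integral_Beta_kernel:
  fixes p q t x :: real
  assumes "0 < p" "0 < q" "t < x"
  shows "((\<lambda>s. (x - s) powr (p - 1) * (s - t) powr (q - 1)) has_integral
     Beta p q * (x - t) powr (p + q - 1)) {t..x}"
proof -
  define l where "l = x - t"
  have l: "0 < l" using assms by (simp add: l_def)
  \<comment> \<open>The right endpoint of the transformed interval, in the form in which the
    substitution rule delivers it.\<close>
  have "(x - t) * (1 + t / (x - t)) = x"
    using assms(3) by (simp add: field_simps)
  then have "((\<lambda>s. (1 / l * s + - t / l) powr (q - 1) * (1 - (1 / l * s + - t / l)) powr (p - 1))
      has_integral l * Beta q p) {t..x}"
    using has_integral_affinity'[OF has_integral_Beta_real[OF assms(2,1), folded box_real(2)], of "1 / l" "- t / l"] l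
    unfolding real_scaleR_def inverse_eq_divide
    by (simp add: mult.commute l_def)
  then have 1: "((\<lambda>s. l powr (p + q - 2) * ((1 / l * s + - t / l) powr (q - 1) * (1 - (1 / l * s + - t / l)) powr (p - 1)))
      has_integral l powr (p + q - 2) * (l * Beta q p)) {t..x}"
    by (rule has_integral_mult_right)
  have 2: "l powr (p + q - 2) * (l * Beta q p) = Beta p q * (x - t) powr (p + q - 1)"
  proof -
    have "l powr (p + q - 2) * l = l powr (p + q - 1)"
      using l powr_add[of l "p + q - 2" 1] by (simp add: algebra_simps)
    then show ?thesis by (simp add: Beta_commute[of q p] l_def)
  qed
  have 3: "l powr (p + q - 2) * ((1 / l * s + - t / l) powr (q - 1) * (1 - (1 / l * s + - t / l)) powr (p - 1))
      = (x - s) powr (p - 1) * (s - t) powr (q - 1)" if "s \<in> {t..x}" for s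
  proof -
    have 1: "1 / l * s + - t / l = (s - t) / l"
      by (simp add: diff_divide_distrib)
    have "(x - s) / l = (l - (s - t)) / l" by (simp add: l_def)
    also have "\<dots> = 1 - (s - t) / l" unfolding diff_divide_distrib[of l] using l by simp
    finally have 2: "1 - (s - t) / l = (x - s) / l" ..
    have "l powr (p + q - 2) = l powr (p - 1) * l powr (q - 1)"
      by (simp add: powr_add[symmetric])
    then show ?thesis unfolding 1 2 using that l by (simp add: powr_divide)
  qed
  show ?thesis using has_integral_eq[OF 3 1] unfolding 2 .
qed

lemma kernel_abs_integrable:
  fixes p q t x :: real
  assumes "0 < p" "0 < q"
  shows "(\<lambda>s. (x - s) powr (p - 1) * (s - t) powr (q - 1)) absolutely_integrable_on {t..x}"
proof (cases "t < x")
  case True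
  show ?thesis
    by (rule nonnegative_absolutely_integrable_1)
      (use has_integral_Beta_kernel[OF assms True] in \<open>auto simp: integrable_on_def\<close>)
next
  case False
  then have "negligible {t..x}" by (cases "t = x") auto
  then show ?thesis by (rule absolutely_integrable_negligible)
qed

lemma integral_kernel:
  fixes p q t x :: real
  assumes "0 < p" "0 < q" "t \<le> x"
  shows "integral {t..x} (\<lambda>s. (x - s) powr (p - 1) * (s - t) powr (q - 1)) = Beta p q * (x - t) powr (p + q - 1)"
  using has_integral_Beta_kernel[OF assms(1,2), of t x] assms(3) by (cases "t = x") (auto intro: integral_unique)

text \<open>Hypothesis \<open>kf\<close> concerns the single point x: for p + q < 1 the kernel is
  singular at t = x, and an L^1 function may fail to be integrable against it. It holds when f is
  continuous and when p + q is at least 1, the two cases used below.\<close>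

lemma RLint_RLint:
  assumes p: "0 < p" and q: "0 < q" and x: "a \<le> x"
    and f: "f absolutely_integrable_on {a..x}"
    and kf: "(\<lambda>t. (x - t) powr (p + q - 1) * f t) absolutely_integrable_on {a..x}"
  shows "(\<lambda>s. (x - s) powr (p - 1) * RLint a q f s) absolutely_integrable_on {a..x}"
    and "RLint a p (RLint a q f) x = RLint a (p + q) f x"
proof -
  define K where "K s t = (x - s) powr (p - 1) * (s - t) powr (q - 1)" for s t
  have K: "case_prod K \<in> borel_measurable (borel \<Otimes>\<^sub>M borel)"
    unfolding K_def by measurable
  have absK: "\<bar>K s t\<bar> = K s t" for s t by (simp add: K_def)
  have Ks: "(\<lambda>s. K s t) absolutely_integrable_on {t..x}" for t
    unfolding K_def using p q by (rule kernel_abs_integrable)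
  have intK: "integral {t..x} (\<lambda>s. K s t) = Beta p q * (x - t) powr (p + q - 1)" if "t \<le> x" for t
    unfolding K_def using p q that by (rule integral_kernel)
  have "(\<lambda>t. Beta p q * norm ((x - t) powr (p + q - 1) * f t)) integrable_on {a..x}"
    using kf integrable_on_cmult_left[of "\<lambda>t. norm ((x - t) powr (p + q - 1) * f t)" "{a..x}" "Beta p q"]
    by (simp add: absolutely_integrable_on_def)
  then have Kf: "(\<lambda>t. integral {t..x} (\<lambda>s. \<bar>K s t\<bar>) * \<bar>f t\<bar>) integrable_on {a..x}"
    by (rule integrable_eq) (simp add: absK intK abs_mult)
  note * = triangle_Fubini[OF f K Ks Kf]
  have Gq: "Gamma q \<noteq> 0" using Gamma_real_pos[OF q] by linarith
  have inner: "integral {a..s} (\<lambda>t. K s t * f t) = Gamma q * ((x - s) powr (p - 1) * RLint a q f s)" for s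
    using Gq q by (simp add: K_def mult.assoc RLint_def)
  have "(\<lambda>s. 1 / Gamma q * (Gamma q * ((x - s) powr (p - 1) * RLint a q f s))) absolutely_integrable_on {a..x}"
    using *(1) unfolding inner by (intro set_integrable_mult_right) auto
  then show "(\<lambda>s. (x - s) powr (p - 1) * RLint a q f s) absolutely_integrable_on {a..x}"
    using Gq by simp
  have "Gamma q * integral {a..x} (\<lambda>s. (x - s) powr (p - 1) * RLint a q f s)
      = integral {a..x} (\<lambda>t. f t * (Beta p q * (x - t) powr (p + q - 1)))"
    using *(2) unfolding inner integral_mult_right
    by (rule trans) (intro integral_cong, simp add: intK)
  also have "\<dots> = Beta p q * integral {a..x} (\<lambda>t. (x - t) powr (p + q - 1) * f t)"
    by (simp add: mult_ac flip: integral_mult_right)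
  finally have "Gamma q * integral {a..x} (\<lambda>s. (x - s) powr (p - 1) * RLint a q f s)
      = Beta p q * integral {a..x} (\<lambda>t. (x - t) powr (p + q - 1) * f t)" .
  moreover have "I / Gamma p = J / Gamma (p + q)" if "Gamma q * I = Beta p q * J" for I J
  proof -
    have "Gamma p \<noteq> 0" "Gamma (p + q) \<noteq> 0"
      using Gamma_real_pos[of p] Gamma_real_pos[of "p + q"] p q by linarith+
    then show ?thesis using that Gq by (simp add: Beta_def field_simps)
  qed
  ultimately show "RLint a p (RLint a q f) x = RLint a (p + q) f x"
    using p q unfolding RLint_def[of a p] RLint_def[of a "p + q"] by simp
qed

section \<open>Integrability, semigroup law and sup bound for the fractional integral\<close>

lemma RLint_0 [simp]: "RLint a 0 f = f"
  by (simp add: RLint_def fun_eq_iff)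

lemma RLint_cong:
  assumes "\<And>t. t \<in> {a..x} \<Longrightarrow> f t = g t" "a \<le> x"
  shows "RLint a n f x = RLint a n g x"
proof (cases "n = 0")
  case False
  have "integral {a..x} (\<lambda>t. (x - t) powr (n - 1) * f t) = integral {a..x} (\<lambda>t. (x - t) powr (n - 1) * g t)"
    by (intro integral_cong) (simp add: assms(1))
  then show ?thesis using False by (simp add: RLint_def)
qed (use assms in simp)

lemma RLint_1: "RLint a 1 f x = integral {a..x} f"
proof -
  \<comment> \<open>Because \<open>0 powr 0 = 0\<close>, the two integrands may differ at t = x, a
    null set.\<close>
  have "integral {a..x} f = integral {a..x} (\<lambda>t. (x - t) powr (1 - 1) * f t)"
    by (rule integral_spike[of "{x}"]) auto
  then show ?thesis by (simp add: RLint_def)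
qed

lemma powr_abs_integrable:
  fixes n x a :: real
  assumes "0 < n"
  shows "(\<lambda>t. (x - t) powr (n - 1)) absolutely_integrable_on {a..x}"
  using kernel_abs_integrable[OF assms zero_less_one, of a x]
  by (rule absolutely_integrable_spike[of _ _ "{a}"]) auto

lemma integral_powr:
  fixes n x a :: real
  assumes "0 < n" "a \<le> x"
  shows "integral {a..x} (\<lambda>t. (x - t) powr (n - 1)) = Beta n 1 * (x - a) powr n"
proof -
  have "integral {a..x} (\<lambda>t. (x - t) powr (n - 1)) = integral {a..x} (\<lambda>t. (x - t) powr (n - 1) * (t - a) powr (1 - 1))"
    by (rule integral_spike[of "{a}"]) auto
  then show ?thesis using integral_kernel[OF assms(1) zero_less_one assms(2)] by simp
qed

lemma continuous_mult_abs_integrable: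
  fixes F g :: "real \<Rightarrow> real"
  assumes "continuous_on {a..b} F" "g absolutely_integrable_on {a..b}"
  shows "(\<lambda>t. g t * F t) absolutely_integrable_on {a..b}"
proof -
  have "(\<lambda>t. F t * g t) absolutely_integrable_on {a..b}"
  proof (rule absolutely_integrable_bounded_measurable_product_real)
    show "F \<in> borel_measurable (lebesgue_on {a..b})"
      using assms(1) by (intro continuous_imp_measurable_on_sets_lebesgue) auto
    show "bounded (F ` {a..b})"
      by (intro compact_imp_bounded compact_continuous_image assms) simp
  qed (use assms in auto)
  then show ?thesis by (simp add: mult.commute)
qed

lemma RLint_integrand_continuous:
  fixes n a x :: real and F :: "real \<Rightarrow> real"
  assumes "0 < n" "continuous_on {a..x} F"
  shows "(\<lambda>t. (x - t) powr (n - 1) * F t) absolutely_integrable_on {a..x}"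
  by (intro continuous_mult_abs_integrable powr_abs_integrable assms)

lemma RLint_integrand_ge_1:
  fixes n a x :: real and f :: "real \<Rightarrow> real"
  assumes "1 \<le> n" "f absolutely_integrable_on {a..x}"
  shows "(\<lambda>t. (x - t) powr (n - 1) * f t) absolutely_integrable_on {a..x}"
proof (cases "n = 1")
  case True
  show ?thesis
    by (rule absolutely_integrable_spike[OF assms(2), of "{x}"]) (use True in auto)
next
  case False
  have "continuous_on {a..x} (\<lambda>t. (x - t) powr (n - 1))"
    using assms(1) False by (intro continuous_on_powr' continuous_intros) auto
  from continuous_mult_abs_integrable[OF this assms(2)] show ?thesis
    by (simp add: mult.commute)
qed

lemma RLint_RLint_continuous:
  assumes "0 \<le> p" "0 \<le> q" "a \<le> x" "continuous_on {a..x} F"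
  shows "RLint a p (RLint a q F) x = RLint a (p + q) F x"
proof (cases "p = 0 \<or> q = 0")
  case False
  then show ?thesis
    using assms
    by (intro RLint_RLint(2) RLint_integrand_continuous absolutely_integrable_continuous_real) auto
qed auto

text \<open>The semigroup lemma with outer order 1 and x = b: its first conclusion has the weight (b
  - s)^0, which is 1 except at s = b, and the total order 1 + n exceeds 1.\<close>

lemma RLint_abs_integrable:
  assumes "0 < n" "a \<le> b" "f absolutely_integrable_on {a..b}"
  shows "RLint a n f absolutely_integrable_on {a..b}"
proof -
  have "(\<lambda>s. (b - s) powr (1 - 1) * RLint a n f s) absolutely_integrable_on {a..b}"
    using assms by (intro RLint_RLint(1) RLint_integrand_ge_1) auto
  then show ?thesis
    by (rule absolutely_integrable_spike[of _ _ "{b}"]) auto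
qed

text \<open>Both sides are the integral of order n + 1, whose kernel is bounded; hence the identity
  holds at every x even for L^1 data.\<close>

lemma RLint_1_RLint_commute:
  assumes "0 < n" "a \<le> x" "f absolutely_integrable_on {a..x}"
  shows "RLint a 1 (RLint a n f) x = RLint a n (RLint a 1 f) x"
proof -
  have "(\<lambda>t. (x - t) powr (1 + n - 1) * f t) absolutely_integrable_on {a..x}"
    using assms by (intro RLint_integrand_ge_1) auto
  then show ?thesis
    using assms RLint_RLint(2)[of 1 n a x f] RLint_RLint(2)[of n 1 a x f] by (simp add: add.commute)
qed

lemma continuous_on_RLint_1:
  assumes "f absolutely_integrable_on {a..b}"
  shows "continuous_on {a..b} (RLint a 1 f)"
  using indefinite_integral_continuous_1[of f a b] assms
  by (simp add: RLint_1[abs_def] absolutely_integrable_on_def)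

lemma RLint_diff:
  assumes "0 < n" "continuous_on {a..x} F" "continuous_on {a..x} G"
  shows "RLint a n F x - RLint a n G x = RLint a n (\<lambda>t. F t - G t) x"
proof -
  have "integral {a..x} (\<lambda>t. (x - t) powr (n - 1) * (F t - G t))
      = integral {a..x} (\<lambda>t. (x - t) powr (n - 1) * F t) - integral {a..x} (\<lambda>t. (x - t) powr (n - 1) * G t)"
    unfolding right_diff_distrib
    using assms by (intro integral_diff set_lebesgue_integral_eq_integral(1) RLint_integrand_continuous)
  then show ?thesis using assms(1) by (simp add: RLint_def diff_divide_distrib)
qed

text \<open>As Beta(n, 1) = 1/n, the constant is (b - a)^n / Gamma(n + 1). What matters is that it
  depends on neither x nor F.\<close>

lemma RLint_bound:
  assumes "0 < n" "x \<in> {a..b}" "continuous_on {a..x} F" "\<And>t. t \<in> {a..x} \<Longrightarrow> \<bar>F t\<bar> \<le> M"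
  shows "\<bar>RLint a n F x\<bar> \<le> Beta n 1 * (b - a) powr n / Gamma n * M"
proof -
  have "M \<ge> 0" using assms(2) assms(4)[of a] by auto
  have "norm (integral {a..x} (\<lambda>t. (x - t) powr (n - 1) * F t)) \<le> integral {a..x} (\<lambda>t. (x - t) powr (n - 1) * M)"
    using assms powr_abs_integrable[of n x a]
    by (intro integral_norm_bound_integral set_lebesgue_integral_eq_integral(1) RLint_integrand_continuous)
      (auto simp: abs_mult intro!: mult_left_mono continuous_intros)
  also have "\<dots> = Beta n 1 * (x - a) powr n * M"
    using integral_powr[of n a x] assms by simp
  also have "\<dots> \<le> Beta n 1 * (b - a) powr n * M"
    using assms \<open>M \<ge> 0\<close> Gamma_real_pos[of n] Gamma_real_pos[of "n + 1"]
    by (intro mult_right_mono mult_left_mono powr_mono2) (auto simp: Beta_def)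
  finally show ?thesis
    using assms(1) Gamma_real_pos[of n] by (simp add: RLint_def divide_right_mono)
qed

section \<open>Approximation of primitives by indefinite integrals\<close>

text \<open>The approximant is the derivative of a Weierstrass polynomial p for F. Its indefinite
  integral is p(x) - p(a), and F(a) = 0 makes p(a) small as well; each of the two errors gets half
  of the tolerance.\<close>

lemma C0_approx:
  assumes "F \<in> C0 a b" "a < b"
  obtains fk where "\<And>k::nat. continuous_on UNIV (fk k)"
    "\<And>k x. x \<in> {a..b} \<Longrightarrow> \<bar>RLint a 1 (fk k) x - F x\<bar> \<le> 1 / Suc k"
proof -
  have "\<exists>f. continuous_on UNIV f \<and> (\<forall>x\<in>{a..b}. \<bar>RLint a 1 f x - F x\<bar> \<le> 1 / Suc k)" for k :: nat
  proof -
    have "continuous_on {a..b} F" "F a = 0" using assms by (auto simp: C0_def)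
    obtain p where p: "real_polynomial_function p" "\<And>x. x \<in> {a..b} \<Longrightarrow> \<bar>F x - p x\<bar> < 1 / Suc k / 2"
      using Stone_Weierstrass_real_polynomial_function[of "{a..b}" F "1 / Suc k / 2"]
        \<open>continuous_on {a..b} F\<close> by auto
    obtain p' where p': "real_polynomial_function p'" "\<And>x. (p has_real_derivative p' x) (at x)"
      using has_real_derivative_polynomial_function[OF p(1)] by blast
    have "continuous_on UNIV p'"
      using p'(1) continuous_on_polymonial_function real_polynomial_function_eq by blast
    moreover have "\<bar>RLint a 1 p' x - F x\<bar> \<le> 1 / Suc k" if x: "x \<in> {a..b}" for x
    proof -
      have "(p' has_integral p x - p a) {a..x}"
        using x p'(2) by (intro fundamental_theorem_of_calculus)
          (auto simp: has_real_derivative_iff_has_vector_derivative[symmetric] intro: has_field_derivative_at_within)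
      then have "RLint a 1 p' x = p x - p a" by (simp add: RLint_1 integral_unique)
      moreover have "\<bar>p a\<bar> < 1 / Suc k / 2" using p(2)[of a] assms(2) \<open>F a = 0\<close> by simp
      moreover have "\<bar>u - v - w\<bar> \<le> r" if "\<bar>v\<bar> < r / 2" "\<bar>w - u\<bar> < r / 2" for u v w r :: real
        using that by linarith
      ultimately show ?thesis using p(2)[OF x] by metis
    qed
    ultimately show ?thesis by blast
  qed
  then show ?thesis using that by metis
qed

text \<open>Membership in \<open>C0\<close> demands the value 0 outside [a, b], so that primitives
  are unique as functions on the whole line. \<open>RLint\<close> does not satisfy this, but
  \<open>regular\<close> sees only [a, b].\<close>

definition restr :: "real \<Rightarrow> real \<Rightarrow> (real \<Rightarrow> real) \<Rightarrow> real \<Rightarrow> real" where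
  "restr a b h = (\<lambda>x. if x \<in> {a..b} then h x else 0)"

lemma restr_in_C0:
  assumes "continuous_on {a..b} h" "h a = 0"
  shows "restr a b h \<in> C0 a b"
proof -
  have "continuous_on {a..b} (restr a b h)"
    using assms(1) by (rule continuous_on_eq) (simp add: restr_def)
  then show ?thesis using assms(2) by (auto simp: C0_def restr_def)
qed

lemma regular_cong:
  assumes "\<And>x. x \<in> {a..b} \<Longrightarrow> F x = G x"
  shows "regular a b F = regular a b G"
proof -
  have "integral {a..b} (\<lambda>x. F x * \<phi> x) = integral {a..b} (\<lambda>x. G x * \<phi> x)" for \<phi>
    by (intro integral_cong) (simp add: assms)
  then show ?thesis by (simp add: regular_def fun_eq_iff)
qed

lemma regular_restr [simp]: "regular a b (restr a b h) = regular a b h"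
  by (rule regular_cong) (simp add: restr_def)

text \<open>This is the limit in the definition of \<open>RLJ\<close> for order in (0,1), read on
  primitives: by commutation the error is the fractional integral of a uniformly small continuous
  function.\<close>

lemma uniform_approx_RLint:
  assumes F: "F \<in> C0 a b" and n: "0 < n"
    and fk: "\<And>k. fk k absolutely_integrable_on {a..b}"
    and lim: "uniform_limit {a..b} (\<lambda>k. RLint a 1 (fk k)) F sequentially"
  shows "uniform_limit {a..b} (\<lambda>k. RLint a 1 (RLint a n (fk k))) (RLint a n F) sequentially"
proof (rule uniform_limitI)
  fix e :: real assume "0 < e"
  define C where "C = Beta n 1 * (b - a) powr n / Gamma n"
  have C: "0 \<le> C" unfolding C_def Beta_def using n Gamma_real_pos[of n] Gamma_real_pos[of "n + 1"]
    by (intro divide_nonneg_nonneg mult_nonneg_nonneg) auto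
  \<comment> \<open>C is only known to be nonnegative; C + 1 keeps the quotient meaningful and makes
    the final estimate strict.\<close>
  have "0 < e / (C + 1)" using \<open>0 < e\<close> C by simp
  from uniform_limitD[OF lim this]
  show "\<forall>\<^sub>F k in sequentially. \<forall>x\<in>{a..b}. dist (RLint a 1 (RLint a n (fk k)) x) (RLint a n F x) < e"
  proof eventually_elim
    case (elim k)
    show ?case
    proof
      fix x assume x: "x \<in> {a..b}"
      have sub: "{a..x} \<subseteq> {a..b}" using x by auto
      have abs_x: "fk k absolutely_integrable_on {a..x}"
        by (rule set_integrable_subset[OF fk]) (use sub in auto)
      have cont: "continuous_on {a..x} (RLint a 1 (fk k))" "continuous_on {a..x} F"
        using continuous_on_RLint_1[OF abs_x] F sub by (auto simp: C0_def intro: continuous_on_subset)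
      have "RLint a 1 (RLint a n (fk k)) x - RLint a n F x = RLint a n (\<lambda>t. RLint a 1 (fk k) t - F t) x"
        using RLint_1_RLint_commute[OF n _ abs_x] RLint_diff[OF n cont] x by simp
      also have "\<bar>\<dots>\<bar> \<le> C * (e / (C + 1))"
        using elim sub cont x
        by (subst C_def) (intro RLint_bound n continuous_intros; fastforce simp: dist_real_def)
      also have "\<dots> < e" using C \<open>0 < e\<close> by (simp add: field_simps)
      finally show "dist (RLint a 1 (RLint a n (fk k)) x) (RLint a n F x) < e"
        by (simp add: dist_real_def)
    qed
  qed
qed

lemma C0_approx_uniform:
  assumes "F \<in> C0 a b" "a < b"
  obtains fk :: "nat \<Rightarrow> real \<Rightarrow> real" where "\<And>k. fk k absolutely_integrable_on {a..b}"
    "uniform_limit {a..b} (\<lambda>k. RLint a 1 (fk k)) F sequentially"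
proof -
  obtain fk where fk: "\<And>k::nat. continuous_on UNIV (fk k)"
    "\<And>k x. x \<in> {a..b} \<Longrightarrow> \<bar>RLint a 1 (fk k) x - F x\<bar> \<le> 1 / Suc k"
    using C0_approx[OF assms] by metis
  have "uniform_limit {a..b} (\<lambda>k. RLint a 1 (fk k)) F sequentially"
  proof (rule uniform_limitI)
    fix e :: real assume "0 < e"
    then have "\<forall>\<^sub>F k in sequentially. 1 / real (Suc k) < e"
      using order_tendstoD(2)[OF LIMSEQ_inverse_real_of_nat] by (simp add: inverse_eq_divide)
    then show "\<forall>\<^sub>F k in sequentially. \<forall>x\<in>{a..b}. dist (RLint a 1 (fk k) x) (F x) < e"
    proof eventually_elim
      case (elim k)
      show ?case
      proof
        fix x assume "x \<in> {a..b}"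
        from fk(2)[OF this, of k] elim show "dist (RLint a 1 (fk k) x) (F x) < e"
          unfolding dist_real_def by (rule le_less_trans)
      qed
    qed
  qed
  moreover have "fk k absolutely_integrable_on {a..b}" for k
    using fk(1)[of k] by (intro absolutely_integrable_continuous_real) (auto intro: continuous_on_subset)
  ultimately show ?thesis using that by blast
qed

text \<open>Each approximant is an indefinite integral, hence continuous, even when the kernel is singular.\<close>

lemma RLint_C0:
  assumes F: "F \<in> C0 a b" and "a < b" "0 \<le> n"
  shows "continuous_on {a..b} (RLint a n F)" "RLint a n F a = 0"
proof -
  show "RLint a n F a = 0" using F by (auto simp: RLint_def C0_def)
  show "continuous_on {a..b} (RLint a n F)"
  proof (cases "n = 0")
    case False
    obtain fk :: "nat \<Rightarrow> real \<Rightarrow> real" where fk: "\<And>k. fk k absolutely_integrable_on {a..b}"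
      "uniform_limit {a..b} (\<lambda>k. RLint a 1 (fk k)) F sequentially"
      using C0_approx_uniform[OF F \<open>a < b\<close>] by metis
    show ?thesis
      by (rule uniform_limit_theorem[OF _ uniform_approx_RLint[OF F _ fk]])
        (use False assms fk in \<open>auto intro!: always_eventually continuous_on_RLint_1 RLint_abs_integrable\<close>)
  qed (use F in \<open>simp add: C0_def\<close>)
qed

subsection \<open>Distributions and their primitives\<close>

text \<open>Integration by parts against a test function, obtained from Fubini with the kernel K(s,
  t) equal to the derivative of the test function at s. Thus no pointwise derivative of the
  indefinite integral is needed for merely integrable h.\<close>

lemma dD_regular_RLint_1:
  assumes "a < b" "h absolutely_integrable_on {a..b}"
  shows "dD a b (regular a b (RLint a 1 h)) = regular a b h"
proof
  fix \<phi>
  show "dD a b (regular a b (RLint a 1 h)) \<phi> = regular a b h \<phi>"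
  proof (cases "\<phi> \<in> test_fun a b")
    case True
    note test = test_fun_deriv[OF True]
    have d\<phi>: "continuous_on S (deriv \<phi>)" for S by (rule test)
    have meas: "(\<lambda>(s, t). deriv \<phi> s) \<in> borel_measurable (borel \<Otimes>\<^sub>M (borel :: real measure))"
    proof -
      have [measurable]: "deriv \<phi> \<in> borel_measurable borel"
        using d\<phi> by (rule borel_measurable_continuous_onI)
      show ?thesis by measurable
    qed
    have abs: "(\<lambda>t. h t * integral {t..b} (\<lambda>s. \<bar>deriv \<phi> s\<bar>)) absolutely_integrable_on {a..b}"
    proof (rule continuous_mult_abs_integrable[OF _ assms(2)])
      show "continuous_on {a..b} (\<lambda>t. integral {t..b} (\<lambda>s. \<bar>deriv \<phi> s\<bar>))"
        by (intro indefinite_integral_continuous_1' integrable_continuous_real continuous_intros d\<phi>)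
    qed
    then have "(\<lambda>t. norm (h t * integral {t..b} (\<lambda>s. \<bar>deriv \<phi> s\<bar>))) integrable_on {a..b}"
      by (simp add: absolutely_integrable_on_def)
    moreover have "0 \<le> integral {t..b} (\<lambda>s. \<bar>deriv \<phi> s\<bar>)" for t
      by (intro integral_nonneg integrable_continuous_real continuous_intros d\<phi>) simp
    ultimately have abs': "(\<lambda>t. integral {t..b} (\<lambda>s. \<bar>deriv \<phi> s\<bar>) * \<bar>h t\<bar>) integrable_on {a..b}"
      by (simp add: abs_mult mult.commute)
    have "integral {a..b} (\<lambda>s. integral {a..s} (\<lambda>t. deriv \<phi> s * h t))
        = integral {a..b} (\<lambda>t. h t * integral {t..b} (\<lambda>s. deriv \<phi> s))"
      by (rule triangle_Fubini(2)[OF assms(2) meas _ abs'])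
        (intro absolutely_integrable_continuous_real d\<phi>)
    also have "\<dots> = integral {a..b} (\<lambda>t. - (h t * \<phi> t))"
    proof (rule integral_cong)
      fix t assume t: "t \<in> {a..b}"
      have "(deriv \<phi> has_integral \<phi> b - \<phi> t) {t..b}"
        using t test(1) by (intro fundamental_theorem_of_calculus)
          (auto simp: has_real_derivative_iff_has_vector_derivative[symmetric] intro: has_field_derivative_at_within)
      moreover have "\<phi> b = 0" by (rule test) simp
      ultimately show "h t * integral {t..b} (deriv \<phi>) = - (h t * \<phi> t)"
        by (simp add: integral_unique)
    qed
    finally show ?thesis
      using True test(2) by (simp add: dD_def regular_def RLint_1[abs_def] mult.commute)
  qed (simp add: dD_def regular_def)
qed

lemma regular_diff:
  assumes "continuous_on {a..b} F" "continuous_on {a..b} G"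
  shows "regular a b F - regular a b G = regular a b (\<lambda>x. F x - G x)"
proof
  fix \<phi>
  show "(regular a b F - regular a b G) \<phi> = regular a b (\<lambda>x. F x - G x) \<phi>"
  proof (cases "\<phi> \<in> test_fun a b")
    case True
    then show ?thesis
      using assms test_fun_deriv(3)[OF True] unfolding regular_def left_diff_distrib
      by (subst integral_diff) (auto intro!: integrable_continuous_real continuous_intros)
  qed (simp add: regular_def)
qed

lemma dD_diff: "dD a b S - dD a b T = dD a b (S - T)"
  by (auto simp: dD_def)

text \<open>The difference is constant on (a, b) by du Bois-Reymond, on [a, b] by continuity, and
  its value at a is 0. Outside [a, b] both functions vanish by the normalisation in
  \<open>C0\<close>.\<close>

lemma dD_regular_inj:
  assumes "a < b" "F \<in> C0 a b" "G \<in> C0 a b"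
    and eq: "dD a b (regular a b F) = dD a b (regular a b G)"
  shows "F = G"
proof -
  define H where "H x = F x - G x" for x
  have cont: "continuous_on {a..b} F" "continuous_on {a..b} G" using assms by (auto simp: C0_def)
  then have H: "continuous_on {a..b} H" unfolding H_def by (intro continuous_intros)
  have "dD a b (regular a b H) = dD a b (regular a b F) - dD a b (regular a b G)"
    by (simp only: dD_diff regular_diff[OF cont] H_def[abs_def])
  then have Hz: "dD a b (regular a b H) \<phi> = 0" for \<phi>
    by (simp add: eq)
  have z: "integral {a..b} (\<lambda>x. H x * deriv \<phi> x) = 0" if "\<phi> \<in> test_fun a b" for \<phi>
    using Hz[of \<phi>] that test_fun_deriv(2)[OF that] by (simp add: dD_def regular_def)
  obtain m where m: "a < m" "m < b" using assms(1) dense by blast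
  have "H x = H m" if "x \<in> {a<..<b}" for x
  proof (cases x m rule: linorder_cases)
    case less
    show ?thesis by (rule du_Bois_Reymond[OF H z]) (use less that m in auto)
  next
    case greater
    show ?thesis by (rule du_Bois_Reymond[OF H z, symmetric]) (use greater that m in auto)
  qed simp
  moreover have "closure {a<..<b} = {a..b}" using assms(1) by simp
  ultimately have "H x = H m" if "x \<in> {a..b}" for x
    using continuous_constant_on_closure[of "{a<..<b}" H "H m" x] H that by metis
  moreover have "H a = 0" using assms(2,3) by (simp add: C0_def H_def)
  ultimately have "H x = 0" if "x \<in> {a..b}" for x
    using that assms(1) by (metis atLeastAtMost_iff less_imp_le order_refl)
  then show ?thesis using assms(2,3) by (force simp: C0_def H_def fun_eq_iff)
qed

lemma prim_dD_regular:
  assumes "a < b" "F \<in> C0 a b"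
  shows "prim a b (dD a b (regular a b F)) = F"
  unfolding prim_def
proof (rule the_equality)
  fix G assume "G \<in> C0 a b \<and> dD a b (regular a b F) = dD a b (regular a b G)"
  then show "G = F" using dD_regular_inj[OF assms(1,2), of G] by blast
qed (use assms(2) in blast)

lemma alex_ge:
  assumes "a < b" "F \<in> C0 a b" "x \<in> {a..b}"
  shows "\<bar>F x\<bar> \<le> alex a b (dD a b (regular a b F))"
proof -
  have "compact ((\<lambda>x. \<bar>F x\<bar>) ` {a..b})"
    using assms by (intro compact_continuous_image continuous_intros) (auto simp: C0_def)
  then show ?thesis
    unfolding alex_def prim_dD_regular[OF assms(1,2)]
    using assms(3) by (intro cSup_upper bounded_imp_bdd_above compact_imp_bounded) auto
qed

lemma alex_le:
  assumes "a < b" "F \<in> C0 a b" "\<And>x. x \<in> {a..b} \<Longrightarrow> \<bar>F x\<bar> \<le> M"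
  shows "alex a b (dD a b (regular a b F)) \<le> M"
  unfolding alex_def prim_dD_regular[OF assms(1,2)]
  using assms by (intro cSup_least) auto

text \<open>The Alexiewicz norm of a derivative is the sup norm of its primitive. Only behaviour on
  [a, b] is assumed, so that the equivalence applies to values of \<open>RLint\<close>; the
  differences are cut off to lie in \<open>C0\<close>.\<close>

lemma alex_tendsto_0_iff:
  assumes ab: "a < b" and Fk: "\<And>k. continuous_on {a..b} (Fk k)" "\<And>k. Fk k a = 0"
    and F: "continuous_on {a..b} F" "F a = 0"
  shows "((\<lambda>k. alex a b (dD a b (regular a b (Fk k)) - dD a b (regular a b F))) \<longlonglongrightarrow> 0)
    \<longleftrightarrow> uniform_limit {a..b} Fk F sequentially"
proof -
  define H where "H k = restr a b (\<lambda>x. Fk k x - F x)" for k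
  have H: "H k \<in> C0 a b" for k
    unfolding H_def using Fk F by (intro restr_in_C0 continuous_intros) auto
  have Hx: "H k x = Fk k x - F x" if "x \<in> {a..b}" for k x using that by (simp add: H_def restr_def)
  have T: "dD a b (regular a b (Fk k)) - dD a b (regular a b F) = dD a b (regular a b (H k))" for k
    unfolding dD_diff H_def regular_restr using Fk F by (subst regular_diff) auto
  have ge: "\<bar>Fk k x - F x\<bar> \<le> alex a b (dD a b (regular a b (H k)))" if "x \<in> {a..b}" for k x
    using alex_ge[OF ab H that, of k] Hx[OF that] by simp
  have pos: "0 \<le> alex a b (dD a b (regular a b (H k)))" for k
    using ge[of a k] ab by (auto intro: order_trans[OF abs_ge_zero])
  show ?thesis unfolding T
  proof
    assume L: "(\<lambda>k. alex a b (dD a b (regular a b (H k)))) \<longlonglongrightarrow> 0"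
    show "uniform_limit {a..b} Fk F sequentially"
    proof (rule uniform_limitI)
      fix e :: real assume "0 < e"
      from order_tendstoD(2)[OF L this]
      show "\<forall>\<^sub>F k in sequentially. \<forall>x\<in>{a..b}. dist (Fk k x) (F x) < e"
        by eventually_elim (auto simp: dist_real_def intro: le_less_trans[OF ge])
    qed
  next
    assume U: "uniform_limit {a..b} Fk F sequentially"
    show "(\<lambda>k. alex a b (dD a b (regular a b (H k)))) \<longlonglongrightarrow> 0"
    proof (rule tendstoI)
      fix e :: real assume "0 < e"
      \<comment> \<open>A supremum of numbers below a bound is only at most that bound; halving
        recovers the strict inequality.\<close>
      then have "0 < e / 2" by simp
      from uniform_limitD[OF U this]
      show "\<forall>\<^sub>F k in sequentially. dist (alex a b (dD a b (regular a b (H k)))) 0 < e"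
      proof eventually_elim
        case (elim k)
        have "alex a b (dD a b (regular a b (H k))) \<le> e / 2"
          using elim Hx by (intro alex_le ab H) (auto simp: dist_real_def less_imp_le)
        then show ?case using pos[of k] \<open>0 < e\<close> by (simp add: dist_real_def)
      qed
    qed
  qed
qed

section \<open>The fractional integral of a distribution\<close>

lemma dD_regular_RLint_in_DHK:
  assumes "F \<in> C0 a b" "a < b" "0 \<le> n"
  shows "dD a b (regular a b (RLint a n F)) \<in> DHK a b"
  unfolding DHK_def
  by (intro CollectI bexI[OF _ restr_in_C0[OF RLint_C0[OF assms]]]) simp

text \<open>The norm limits in the definite description become uniform limits of primitives
  (\<open>conv1\<close>, \<open>conv2\<close>). A competing g comes with its own sequence, but the
  integrals of that sequence also converge to the fractional integral of F, so its primitive is the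
  same on [a, b].\<close>

lemma RLJ_less_1:
  assumes ab: "a < b" and F: "F \<in> C0 a b" and n: "0 < n" "n < 1"
  shows "RLJ a b n (dD a b (regular a b F)) = dD a b (regular a b (RLint a n F))"
proof -
  have contF: "continuous_on {a..b} F" "F a = 0" using F by (auto simp: C0_def)
  have J: "(\<lambda>x. 1 / Gamma n * integral {a..x} (\<lambda>t. rl_kernel n x t * f t)) = RLint a n f" for f
    using n by (simp add: RLint_def rl_kernel_def fun_eq_iff)
  have conv1: "((\<lambda>k. alex a b (regular a b (fk k) - dD a b (regular a b F))) \<longlonglongrightarrow> 0)
      \<longleftrightarrow> uniform_limit {a..b} (\<lambda>k. RLint a 1 (fk k)) F sequentially"
    if "\<And>k. fk k absolutely_integrable_on {a..b}" for fk :: "nat \<Rightarrow> real \<Rightarrow> real"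
    using alex_tendsto_0_iff[OF ab _ _ contF, of "\<lambda>k. RLint a 1 (fk k)"] that
    by (simp add: dD_regular_RLint_1[OF ab] continuous_on_RLint_1 RLint_1[of a _ a])
  have conv2: "((\<lambda>k. alex a b (regular a b (RLint a n (fk k)) - dD a b (regular a b G))) \<longlonglongrightarrow> 0)
      \<longleftrightarrow> uniform_limit {a..b} (\<lambda>k. RLint a 1 (RLint a n (fk k))) G sequentially"
    if "\<And>k. fk k absolutely_integrable_on {a..b}" "continuous_on {a..b} G" "G a = 0"
    for fk :: "nat \<Rightarrow> real \<Rightarrow> real" and G
    using alex_tendsto_0_iff[OF ab _ _ that(2,3), of "\<lambda>k. RLint a 1 (RLint a n (fk k))"] that(1) n ab
    by (simp add: dD_regular_RLint_1[OF ab] continuous_on_RLint_1 RLint_abs_integrable RLint_1[of a _ a])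
  let ?P = "\<lambda>g. g \<in> DHK a b \<and>
          (\<exists>fk :: nat \<Rightarrow> real \<Rightarrow> real.
             (\<forall>k. fk k absolutely_integrable_on {a..b}) \<and>
             ((\<lambda>k. alex a b (regular a b (fk k) - dD a b (regular a b F))) \<longlonglongrightarrow> 0) \<and>
             ((\<lambda>k. alex a b (regular a b (RLint a n (fk k)) - g)) \<longlonglongrightarrow> 0))"
  have "(THE g. ?P g) = dD a b (regular a b (RLint a n F))"
  proof (rule the_equality)
    obtain fk :: "nat \<Rightarrow> real \<Rightarrow> real" where fk: "\<And>k. fk k absolutely_integrable_on {a..b}"
      "uniform_limit {a..b} (\<lambda>k. RLint a 1 (fk k)) F sequentially"
      using C0_approx_uniform[OF F ab] by metis
    have n0: "0 \<le> n" using n by simp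
    show "?P (dD a b (regular a b (RLint a n F)))"
    proof (intro conjI exI[of _ fk] allI fk(1))
      show "dD a b (regular a b (RLint a n F)) \<in> DHK a b"
        by (rule dD_regular_RLint_in_DHK[OF F ab n0])
      show "(\<lambda>k. alex a b (regular a b (fk k) - dD a b (regular a b F))) \<longlonglongrightarrow> 0"
        using conv1[OF fk(1)] fk(2) by (rule iffD2)
      show "(\<lambda>k. alex a b (regular a b (RLint a n (fk k)) - dD a b (regular a b (RLint a n F)))) \<longlonglongrightarrow> 0"
        using conv2[OF fk(1) RLint_C0[OF F ab n0]] uniform_approx_RLint[OF F n(1) fk] by (rule iffD2)
    qed
  next
    fix g assume "?P g"
    then obtain G fk where G: "G \<in> C0 a b" "g = dD a b (regular a b G)"
      and fk: "\<And>k. fk k absolutely_integrable_on {a..b}"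
      "(\<lambda>k. alex a b (regular a b (fk k) - dD a b (regular a b F))) \<longlonglongrightarrow> 0"
      "(\<lambda>k. alex a b (regular a b (RLint a n (fk k)) - g)) \<longlonglongrightarrow> 0"
      unfolding DHK_def by blast
    have lim_F: "uniform_limit {a..b} (\<lambda>k. RLint a 1 (RLint a n (fk k))) (RLint a n F) sequentially"
      by (rule uniform_approx_RLint[OF F n(1) fk(1) iffD1[OF conv1[OF fk(1)] fk(2)]])
    have lim_G: "uniform_limit {a..b} (\<lambda>k. RLint a 1 (RLint a n (fk k))) G sequentially"
    proof (rule iffD1[OF conv2[OF fk(1)]])
      show "continuous_on {a..b} G" "G a = 0" using G(1) by (simp_all add: C0_def)
      show "(\<lambda>k. alex a b (regular a b (RLint a n (fk k)) - dD a b (regular a b G))) \<longlonglongrightarrow> 0"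
        using fk(3) unfolding G(2) .
    qed
    have "RLint a n F x = G x" if "x \<in> {a..b}" for x
      by (rule LIMSEQ_unique[OF tendsto_uniform_limitI[OF lim_F that] tendsto_uniform_limitI[OF lim_G that]])
    then show "g = dD a b (regular a b (RLint a n F))"
      unfolding G(2) by (intro arg_cong[where f = "dD a b"] regular_cong) simp
  qed
  then show ?thesis using n unfolding RLJ_def J by simp
qed

text \<open>The index drops by one because \<^const>\<open>RLJ\<close> for \<open>n \<ge> 1\<close> yields the function
  itself, whereas \<open>RLint a n F\<close> is its primitive.\<close>

lemma dint_mult_kernel:
  assumes ab: "a < b" and F: "F \<in> C0 a b" and n: "1 \<le> n" and x: "x \<in> {a..b}"
  shows "1 / Gamma n * dint_mult a b (dD a b (regular a b F)) (rl_kernel n x) a x = RLint a (n - 1) F x"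
proof -
  have F0: "F a = 0" using F by (simp add: C0_def)
  note dm = dint_mult_def prim_dD_regular[OF ab F]
  show ?thesis
  proof (cases "n = 1")
    case True
    \<comment> \<open>For order 1 the kernel is constant and only the boundary term F(x) survives,
      which is the integral of order 0.\<close>
    then have "deriv (rl_kernel n x) = (\<lambda>_. 0)" by (simp add: rl_kernel_def[abs_def])
    then show ?thesis using True F0 by (simp add: dm) (simp add: rl_kernel_def)
  next
    case False
    then have n1: "1 < n" using n by simp
    have D: "deriv (rl_kernel n x) t = - (n - 1) * (x - t) powr (n - 1 - 1)" if "t < x" for t
    proof (rule DERIV_imp_deriv)
      have "((\<lambda>t. (x - t) powr (n - 1)) has_real_derivative - (n - 1) * (x - t) powr (n - 1 - 1)) (at t)"
        using that DERIV_chain2[of "\<lambda>z. z powr (n - 1)" _ "\<lambda>t. x - t" t "- 1", OF has_real_derivative_powr]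
        by (auto intro!: derivative_eq_intros simp: left_diff_distrib)
      then show "(rl_kernel n x has_real_derivative - (n - 1) * (x - t) powr (n - 1 - 1)) (at t)"
        using False by (simp add: rl_kernel_def[abs_def])
    qed
    \<comment> \<open>The derivative of the kernel is known only for t < x; the point t = x is
      discarded as a null set.\<close>
    have "integral {a..x} (\<lambda>t. F t * deriv (rl_kernel n x) t)
        = integral {a..x} (\<lambda>t. - (n - 1) * ((x - t) powr (n - 1 - 1) * F t))"
      by (rule integral_spike[of "{x}"]) (auto simp: D)
    also have "\<dots> = - (n - 1) * integral {a..x} (\<lambda>t. (x - t) powr (n - 1 - 1) * F t)"
      by (rule integral_mult_right)
    finally have I: "integral {a..x} (\<lambda>t. F t * deriv (rl_kernel n x) t)
        = - (n - 1) * integral {a..x} (\<lambda>t. (x - t) powr (n - 1 - 1) * F t)" .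
    have "Gamma n = (n - 1) * Gamma (n - 1)"
      using Gamma_plus1[of "n - 1"] n1 by (auto simp: nonpos_Ints_def)
    moreover have "- ((1 - n) * J / ((n - 1) * G)) = J / G" for J G
    proof -
      have "(1 - n) * J = - ((n - 1) * J)" by (simp add: algebra_simps)
      then show ?thesis using n1 by simp
    qed
    \<comment> \<open>Both boundary terms vanish: F is 0 at a, and the kernel is
      \<open>0 powr (n - 1) = 0\<close> at t = x. The factor n - 1 is absorbed by the functional
      equation of Gamma.\<close>
    ultimately show ?thesis
      using F0 n1 by (simp add: dm I) (simp add: RLint_def rl_kernel_def)
  qed
qed

lemma RLJ_dD_regular:
  assumes ab: "a < b" and F: "F \<in> C0 a b" and n: "0 \<le> n"
  shows "RLJ a b n (dD a b (regular a b F)) = dD a b (regular a b (RLint a n F))"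
proof -
  consider "n = 0" | "0 < n" "n < 1" | "1 \<le> n" using n by linarith
  then show ?thesis
  proof cases
    case 1
    then show ?thesis by (simp add: RLJ_def)
  next
    case 2
    then show ?thesis using RLJ_less_1[OF ab F] by simp
  next
    case 3
    have contF: "continuous_on {a..b} F" using F by (auto simp: C0_def)
    \<comment> \<open>The value is a continuous function; rewriting it as the derivative of its own
      indefinite integral restores the missing order.\<close>
    have "RLJ a b n (dD a b (regular a b F)) = regular a b (RLint a (n - 1) F)"
      using 3 dint_mult_kernel[OF ab F 3] by (auto simp: RLJ_def intro!: regular_cong)
    also have "\<dots> = dD a b (regular a b (RLint a 1 (RLint a (n - 1) F)))"
      using 3 RLint_C0(1)[OF F ab, of "n - 1"]
      by (intro dD_regular_RLint_1[symmetric] ab absolutely_integrable_continuous_real) simp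
    also have "regular a b (RLint a 1 (RLint a (n - 1) F)) = regular a b (RLint a n F)"
    proof (rule regular_cong)
      fix x assume "x \<in> {a..b}"
      then show "RLint a 1 (RLint a (n - 1) F) x = RLint a n F x"
        using 3 continuous_on_subset[OF contF, of "{a..x}"] RLint_RLint_continuous[of 1 "n - 1" a x F] by simp
    qed
    finally show ?thesis .
  qed
qed

section \<open>The fractional derivative of a fractional integral\<close>

lemma dD_funpow_RLint:
  assumes ab: "a < b" and F: "F \<in> C0 a b" and r: "0 \<le> r"
  shows "(dD a b ^^ m) (dD a b (regular a b (RLint a (real m + r) F))) = dD a b (regular a b (RLint a r F))"
proof (induction m)
  case (Suc m)
  let ?s = "real m + r"
  have contF: "continuous_on {a..b} F" using F by (auto simp: C0_def)
  have "regular a b (RLint a (real (Suc m) + r) F) = regular a b (RLint a 1 (RLint a ?s F))"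
  proof (rule regular_cong)
    fix x assume "x \<in> {a..b}"
    then show "RLint a (real (Suc m) + r) F x = RLint a 1 (RLint a ?s F) x"
      using r continuous_on_subset[OF contF, of "{a..x}"] RLint_RLint_continuous[of 1 ?s a x F]
      by (simp add: add.assoc)
  qed
  moreover have "dD a b (regular a b (RLint a 1 (RLint a ?s F))) = regular a b (RLint a ?s F)"
    using r RLint_C0(1)[OF F ab, of ?s]
    by (intro dD_regular_RLint_1 ab absolutely_integrable_continuous_real) simp
  ultimately show ?case using Suc.IH by (simp only: funpow_Suc_right o_apply)
qed simp

text \<open>With m the ceiling of n, the integral of order m - n raises n + r to m + r, and m
  distributional derivatives lower this to r. The remaining r is what lets the result be
  differentiated fractionally again.\<close>

lemma RLD_RLint:
  assumes ab: "a < b" and F: "F \<in> C0 a b" and n: "0 \<le> n" and r: "0 \<le> r"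
  shows "RLD a b n (dD a b (regular a b (RLint a (n + r) F))) = dD a b (regular a b (RLint a r F))"
proof (cases "n = 0")
  case False
  define m where "m = nat \<lceil>n\<rceil>"
  have m: "n \<le> real m" using n by (simp add: m_def)
  \<comment> \<open>The evaluation of \<open>RLJ\<close> asks for a primitive in \<open>C0\<close>,
    hence the cut-off; it is undone under the integral, which looks only at [a, x].\<close>
  define G where "G = restr a b (RLint a (n + r) F)"
  have nr: "0 \<le> n + r" using n r by simp
  have G: "G \<in> C0 a b" unfolding G_def by (rule restr_in_C0[OF RLint_C0[OF F ab nr]])
  have contF: "continuous_on {a..b} F" using F by (auto simp: C0_def)
  have "RLJ a b (real m - n) (dD a b (regular a b G)) = dD a b (regular a b (RLint a (real m - n) G))"
    using m by (intro RLJ_dD_regular ab G) simp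
  also have "regular a b (RLint a (real m - n) G) = regular a b (RLint a (real m + r) F)"
  proof (rule regular_cong)
    fix x assume x: "x \<in> {a..b}"
    have "RLint a (real m - n) G x = RLint a (real m - n) (RLint a (n + r) F) x"
      using x by (intro RLint_cong) (auto simp: G_def restr_def)
    also have "\<dots> = RLint a (real m - n + (n + r)) F x"
      using x m nr by (intro RLint_RLint_continuous continuous_on_subset[OF contF]) auto
    finally show "RLint a (real m - n) G x = RLint a (real m + r) F x" by simp
  qed
  finally have "RLJ a b (real m - n) (dD a b (regular a b (RLint a (n + r) F)))
      = dD a b (regular a b (RLint a (real m + r) F))"
    by (simp add: G_def)
  then show ?thesis using False dD_funpow_RLint[OF ab F r, of m] by (simp add: RLD_def m_def)
qed (simp add: RLD_def)

theorem theorem4p9: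
  fixes a b n1 n2 :: real and g :: distr
  assumes "a < b" and "0 \<le> n1" and "0 \<le> n2" and "g \<in> DHK a b"
  shows "RLD a b n1 (RLD a b n2 (RLJ a b (n1 + n2) g)) = RLD a b (n1 + n2) (RLJ a b (n1 + n2) g)"
proof -
  obtain F where F: "F \<in> C0 a b" and g: "g = dD a b (regular a b F)"
    using assms(4) unfolding DHK_def by blast
  have J: "RLJ a b (n1 + n2) g = dD a b (regular a b (RLint a (n1 + n2) F))"
    unfolding g using assms(2,3) by (intro RLJ_dD_regular F assms(1)) simp
  have "RLD a b n2 (RLJ a b (n1 + n2) g) = dD a b (regular a b (RLint a n1 F))"
    using RLD_RLint[OF assms(1) F assms(3,2)] by (simp add: J add.commute)
  moreover have "RLD a b n1 (dD a b (regular a b (RLint a n1 F))) = g"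
    \<comment> \<open>With r = 0 the whole order is consumed and the integral of order 0 is F
      itself, whose derivative is g.\<close>
    using RLD_RLint[OF assms(1) F assms(2), of 0] by (simp add: g)
  moreover have "RLD a b (n1 + n2) (RLJ a b (n1 + n2) g) = g"
    using RLD_RLint[OF assms(1) F, of "n1 + n2" 0] assms(2,3) by (simp add: g J[unfolded g])
  ultimately show ?thesis by simp
qed

end
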